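(* Let $\Sigma$ be an abstract simplicial complex on the finite vertex set $V$ with $n=\#V$. Let $\circ\in\{+,-,H\}$ and, for each $k$, let $\lambda_k^\circ=\max\sigma(\Delta_k^\circ)$. Then for every $1\le k\le\dim(\Sigma)$, \[\lambda_k^\circ\le\lambda_{k-1}^\circ .\] Furthermore, $\lambda_k^H=\lambda_k^-$ for every $1\le k\le\dim(\Sigma)$.
   Context: A simplicial complex on a finite set $V$ is a family $\Sigma\subseteq\mathcal P(V)$ closed under taking subsets. $\Sigma_k$ is the set of $\sigma\in\Sigma$ with $\#\sigma=k+1$ (so $\Sigma_{-1}=\{\emptyset\}$ for nonempty $\Sigma$), and $\dim(\Sigma)=\max\{k\mid\Sigma_k\ne\emptyset\}$. Write $\tau\prec\sigma$ if $\tau\subseteq\sigma$ and $\#(\sigma\setminus\tau)=1$. $\mathcal K=\mathcal P(V)$ is the complete complex, $\mathcal K_k$ its simplices of cardinality $k+1$. $\ell^2(\Sigma_k)$ is the space of real (or complex) valued functions on $\Sigma_k$ with $\langle\phi,\psi\rangle=\sum_{\tau\in\Sigma_k}\phi(\tau)\overline{\psi(\tau)}$. Coboundary operators are linear maps $\delta_k:\ell^2(\Sigma_k)\to\ell^2(\Sigma_{k+1})$, $k\ge-1$, with $\delta_{k+1}\delta_k=0$ and $\delta_k1_\tau(\sigma)\in\{\pm1,0\}$, nonzero iff $\tau\prec\sigma$. They are chosen as follows: fix coboundary operators $\widehat\delta_k$ for $\mathcal K$ and put $\delta_k=\pi_{k+1}\widehat\delta_k\iota_k$, where $\iota_k:\ell^2(\Sigma_k)\to\ell^2(\mathcal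 K_k)$ is extension by zero and $\pi_k:\ell^2(\mathcal K_k)\to\ell^2(\Sigma_k)$ is restriction. (The usual oriented simplicial coboundary of the augmented cochain complex is an example; the spectra below do not depend on the choice.) Let $\partial_k=\delta_k^*$ be the adjoint and \[\Delta_k^+=\partial_k\delta_k,\qquad \Delta_k^-=\delta_{k-1}\partial_{k-1},\qquad \Delta_k^H=\Delta_k^++\Delta_k^-\qquad(k\ge0)\] acting on $\ell^2(\Sigma_k)$. $\sigma(A)$ denotes the spectrum of an operator $A$. *)

theory Defs
  imports Complex_Main
begin

definition simplicial_complex :: "'v set \<Rightarrow> 'v set set \<Rightarrow> bool" where
  "simplicial_complex V X \<longleftrightarrow> X \<subseteq> Pow V \<and> (\<forall>\<sigma>\<in>X. \<forall>\<tau>\<subseteq>\<sigma>. \<tau> \<in> X)"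

definition simplices :: "'v set set \<Rightarrow> int \<Rightarrow> 'v set set" where
  "simplices X k = {\<sigma> \<in> X. int (card \<sigma>) = k + 1}"

text \<open>The void complex (no simplices, not even the empty one) has no maximum to take; its
  dimension is set to -2, below the dimension -1 of the complex whose only simplex is empty.\<close>

definition complex_dim :: "'v set set \<Rightarrow> int" where
  "complex_dim X = (if X = {} then -2 else Max {k. simplices X k \<noteq> {}})"

definition covers :: "'v set \<Rightarrow> 'v set \<Rightarrow> bool" where
  "covers \<tau> \<sigma> \<longleftrightarrow> \<tau> \<subseteq> \<sigma> \<and> card (\<sigma> - \<tau>) = 1"

text \<open>A function on \<open>S\<close> is represented by its extension by zero to the whole type. Hence, for
  \<open>S \<subseteq> T\<close>, \<open>l2 S \<subseteq> l2 T\<close> and this inclusion is the operator of extension by zero from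
  \<open>S\<close> to \<open>T\<close>.\<close>

definition l2 :: "'s set \<Rightarrow> ('s \<Rightarrow> 'a::zero) set" where
  "l2 S = {\<phi>. \<forall>x. x \<notin> S \<longrightarrow> \<phi> x = 0}"

definition l2_restrict :: "'s set \<Rightarrow> ('s \<Rightarrow> 'a::zero) \<Rightarrow> 's \<Rightarrow> 'a" where
  "l2_restrict S \<phi> = (\<lambda>x. if x \<in> S then \<phi> x else 0)"

text \<open>The argument \<open>cj\<close> is the conjugation of the scalar field: the identity for real scalars,
  \<^const>\<open>cnj\<close> for complex ones.\<close>

definition l2_inner :: "('a::real_normed_field \<Rightarrow> 'a) \<Rightarrow> 's set \<Rightarrow> ('s \<Rightarrow> 'a) \<Rightarrow> ('s \<Rightarrow> 'a) \<Rightarrow> 'a" where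
  "l2_inner cj S \<phi> \<psi> = (\<Sum>x\<in>S. \<phi> x * cj (\<psi> x))"

definition l2_linear :: "'s set \<Rightarrow> 't set \<Rightarrow> (('s \<Rightarrow> 'a::real_normed_field) \<Rightarrow> ('t \<Rightarrow> 'a)) \<Rightarrow> bool" where
  "l2_linear S T A \<longleftrightarrow>
     (\<forall>\<phi>\<in>l2 S. A \<phi> \<in> l2 T) \<and>
     (\<forall>\<phi>\<in>l2 S. \<forall>\<psi>\<in>l2 S. A (\<lambda>x. \<phi> x + \<psi> x) = (\<lambda>y. A \<phi> y + A \<psi> y)) \<and>
     (\<forall>c. \<forall>\<phi>\<in>l2 S. A (\<lambda>x. c * \<phi> x) = (\<lambda>y. c * A \<phi> y))"

text \<open>The adjoint of a linear map \<open>A\<close> from \<open>l2 S\<close> to \<open>l2 T\<close>. For finite \<open>S\<close> the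
  description determines a unique function for every \<open>\<psi>\<close> (see \<open>l2_adjoint\<close> below).\<close>

definition l2_adj ::
  "('a::real_normed_field \<Rightarrow> 'a) \<Rightarrow> 's set \<Rightarrow> 't set \<Rightarrow> (('s \<Rightarrow> 'a) \<Rightarrow> ('t \<Rightarrow> 'a)) \<Rightarrow> ('t \<Rightarrow> 'a) \<Rightarrow> ('s \<Rightarrow> 'a)" where
  "l2_adj cj S T A \<psi> =
     (THE \<chi>. \<chi> \<in> l2 S \<and> (\<forall>\<phi>\<in>l2 S. l2_inner cj T (A \<phi>) \<psi> = l2_inner cj S \<phi> \<chi>))"

lemma l2_adjoint:
  fixes cj :: "'a::real_normed_field \<Rightarrow> 'a"
  assumes S: "finite S" and A: "l2_linear S T A" and cj: "\<And>z. cj (cj z) = z"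
  shows "l2_adj cj S T A \<psi> \<in> l2 S"
    and "\<phi> \<in> l2 S \<Longrightarrow> l2_inner cj T (A \<phi>) \<psi> = l2_inner cj S \<phi> (l2_adj cj S T A \<psi>)"
proof -
  define e :: "'b \<Rightarrow> 'b \<Rightarrow> 'a" where "e x = (\<lambda>y. if y = x then 1 else 0)" for x
  define \<chi> where "\<chi> = (\<lambda>x. if x \<in> S then cj (l2_inner cj T (A (e x)) \<psi>) else 0)"
  have e: "e x \<in> l2 S" if "x \<in> S" for x
    using that by (auto simp: e_def l2_def)
  have add: "A (\<lambda>x. \<alpha> x + \<beta> x) = (\<lambda>y. A \<alpha> y + A \<beta> y)" if "\<alpha> \<in> l2 S" "\<beta> \<in> l2 S" for \<alpha> \<beta>
    using A that unfolding l2_linear_def by blast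
  have scale: "A (\<lambda>x. c * \<alpha> x) = (\<lambda>y. c * A \<alpha> y)" if "\<alpha> \<in> l2 S" for c \<alpha>
    using A that unfolding l2_linear_def by blast
  have expand: "A (\<lambda>y. \<Sum>x\<in>F. \<phi> x * e x y) = (\<lambda>y. \<Sum>x\<in>F. \<phi> x * A (e x) y)"
    if "finite F" "F \<subseteq> S" for F \<phi>
    using that
  proof (induction F rule: finite_induct)
    case empty
    have "(\<lambda>_. 0) \<in> l2 S" by (simp add: l2_def)
    from scale[OF this, of 0] show ?case by simp
  next
    case (insert x F)
    have "(\<lambda>y. \<phi> x * e x y) \<in> l2 S" "(\<lambda>y. \<Sum>x\<in>F. \<phi> x * e x y) \<in> l2 S"
      using insert.prems e by (auto simp: l2_def intro!: sum.neutral)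
    from add[OF this] scale[OF e, of x "\<phi> x"] insert show ?case by simp
  qed
  have \<chi>: "\<chi> \<in> l2 S" by (simp add: \<chi>_def l2_def)
  have adj: "l2_inner cj T (A \<phi>) \<psi> = l2_inner cj S \<phi> \<chi>" if "\<phi> \<in> l2 S" for \<phi>
  proof -
    have "\<phi> = (\<lambda>y. \<Sum>x\<in>S. \<phi> x * e x y)"
      using that S by (auto simp: e_def l2_def fun_eq_iff if_distrib cong: if_cong)
    then have "A \<phi> = (\<lambda>y. \<Sum>x\<in>S. \<phi> x * A (e x) y)"
      using expand[OF S order_refl, of \<phi>] by simp
    then have "l2_inner cj T (A \<phi>) \<psi> = (\<Sum>y\<in>T. \<Sum>x\<in>S. \<phi> x * (A (e x) y * cj (\<psi> y)))"
      by (simp add: l2_inner_def sum_distrib_right mult.assoc)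
    also have "\<dots> = (\<Sum>x\<in>S. \<phi> x * l2_inner cj T (A (e x)) \<psi>)"
      by (subst sum.swap) (simp add: l2_inner_def sum_distrib_left)
    finally show ?thesis by (simp add: l2_inner_def \<chi>_def cj)
  qed
  have inner_e: "l2_inner cj S (e x) \<xi> = cj (\<xi> x)" if "x \<in> S" for x \<xi>
  proof -
    have "l2_inner cj S (e x) \<xi> = (\<Sum>y\<in>S. if y = x then cj (\<xi> y) else 0)"
      unfolding l2_inner_def e_def by (rule sum.cong) auto
    then show ?thesis using S that by simp
  qed
  have unique: "\<xi> = \<chi>"
    if "\<xi> \<in> l2 S" and *: "\<forall>\<phi>\<in>l2 S. l2_inner cj T (A \<phi>) \<psi> = l2_inner cj S \<phi> \<xi>" for \<xi>
  proof
    fix x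
    show "\<xi> x = \<chi> x"
    proof (cases "x \<in> S")
      case True
      then have "cj (\<xi> x) = cj (\<chi> x)" using * adj[OF e] e inner_e by metis
      then show ?thesis by (metis cj)
    next
      case False
      then show ?thesis using that(1) \<chi> by (simp add: l2_def)
    qed
  qed
  have "l2_adj cj S T A \<psi> = \<chi>"
    unfolding l2_adj_def by (rule the_equality) (use \<chi> adj unique in blast)+
  then show "l2_adj cj S T A \<psi> \<in> l2 S"
    and "\<phi> \<in> l2 S \<Longrightarrow> l2_inner cj T (A \<phi>) \<psi> = l2_inner cj S \<phi> (l2_adj cj S T A \<psi>)"
    using \<chi> adj by auto
qed

definition l2_spectrum :: "'s set \<Rightarrow> (('s \<Rightarrow> 'a::real_normed_field) \<Rightarrow> ('s \<Rightarrow> 'a)) \<Rightarrow> 'a set" where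
  "l2_spectrum S A = {\<mu>. \<not> bij_betw (\<lambda>\<phi> x. A \<phi> x - \<mu> * \<phi> x) (l2 S) (l2 S)}"

definition coboundary_operators ::
  "'v set set \<Rightarrow> (int \<Rightarrow> ('v set \<Rightarrow> 'a::real_normed_field) \<Rightarrow> ('v set \<Rightarrow> 'a)) \<Rightarrow> bool" where
  "coboundary_operators X d \<longleftrightarrow>
     (\<forall>k\<ge>-1.
        l2_linear (simplices X k) (simplices X (k + 1)) (d k) \<and>
        (\<forall>\<phi>\<in>l2 (simplices X k). d (k + 1) (d k \<phi>) = (\<lambda>_. 0)) \<and>
        (\<forall>\<tau>\<in>simplices X k. \<forall>\<sigma>\<in>simplices X (k + 1).
           d k (\<lambda>\<rho>. if \<rho> = \<tau> then 1 else 0) \<sigma> \<in> {1, -1, 0} \<and>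
           (d k (\<lambda>\<rho>. if \<rho> = \<tau> then 1 else 0) \<sigma> \<noteq> 0 \<longleftrightarrow> covers \<tau> \<sigma>)))"

text \<open>Here \<open>d\<close> is the family of coboundary operators of the complete complex. Extension by zero
  is the inclusion \<open>l2 (simplices X k) \<subseteq> l2 (simplices (Pow V) k)\<close>, so it leaves no trace in
  the formula.\<close>

definition coboundary ::
  "'v set set \<Rightarrow> (int \<Rightarrow> ('v set \<Rightarrow> 'a::real_normed_field) \<Rightarrow> ('v set \<Rightarrow> 'a)) \<Rightarrow>
   int \<Rightarrow> ('v set \<Rightarrow> 'a) \<Rightarrow> ('v set \<Rightarrow> 'a)" where
  "coboundary X d k \<phi> = l2_restrict (simplices X (k + 1)) (d k \<phi>)"

definition boundary ::
  "('a::real_normed_field \<Rightarrow> 'a) \<Rightarrow> 'v set set \<Rightarrow> (int \<Rightarrow> ('v set \<Rightarrow> 'a) \<Rightarrow> ('v set \<Rightarrow> 'a)) \<Rightarrow>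
   int \<Rightarrow> ('v set \<Rightarrow> 'a) \<Rightarrow> ('v set \<Rightarrow> 'a)" where
  "boundary cj X d k = l2_adj cj (simplices X k) (simplices X (k + 1)) (coboundary X d k)"

datatype laplacian_kind = Up | Down | Hodge

definition up_laplacian ::
  "('a::real_normed_field \<Rightarrow> 'a) \<Rightarrow> 'v set set \<Rightarrow> (int \<Rightarrow> ('v set \<Rightarrow> 'a) \<Rightarrow> ('v set \<Rightarrow> 'a)) \<Rightarrow>
   int \<Rightarrow> ('v set \<Rightarrow> 'a) \<Rightarrow> ('v set \<Rightarrow> 'a)" where
  "up_laplacian cj X d k \<phi> = boundary cj X d k (coboundary X d k \<phi>)"

definition down_laplacian ::
  "('a::real_normed_field \<Rightarrow> 'a) \<Rightarrow> 'v set set \<Rightarrow> (int \<Rightarrow> ('v set \<Rightarrow> 'a) \<Rightarrow> ('v set \<Rightarrow> 'a)) \<Rightarrow>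
   int \<Rightarrow> ('v set \<Rightarrow> 'a) \<Rightarrow> ('v set \<Rightarrow> 'a)" where
  "down_laplacian cj X d k \<phi> = coboundary X d (k - 1) (boundary cj X d (k - 1) \<phi>)"

fun laplacian ::
  "('a::real_normed_field \<Rightarrow> 'a) \<Rightarrow> 'v set set \<Rightarrow> (int \<Rightarrow> ('v set \<Rightarrow> 'a) \<Rightarrow> ('v set \<Rightarrow> 'a)) \<Rightarrow>
   laplacian_kind \<Rightarrow> int \<Rightarrow> ('v set \<Rightarrow> 'a) \<Rightarrow> ('v set \<Rightarrow> 'a)" where
  "laplacian cj X d Up k \<phi> = up_laplacian cj X d k \<phi>"
| "laplacian cj X d Down k \<phi> = down_laplacian cj X d k \<phi>"
| "laplacian cj X d Hodge k \<phi> = (\<lambda>\<sigma>. up_laplacian cj X d k \<phi> \<sigma> + down_laplacian cj X d k \<phi> \<sigma>)"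

text \<open>The Laplacians are self-adjoint, so their spectra consist of real scalars; since the complex
  numbers carry no linear order, the maximum is taken over the corresponding real numbers.\<close>

definition max_eigenvalue ::
  "('a::real_normed_field \<Rightarrow> 'a) \<Rightarrow> 'v set set \<Rightarrow> (int \<Rightarrow> ('v set \<Rightarrow> 'a) \<Rightarrow> ('v set \<Rightarrow> 'a)) \<Rightarrow>
   laplacian_kind \<Rightarrow> int \<Rightarrow> real" where
  "max_eigenvalue cj X d t k =
     Max {x. of_real x \<in> l2_spectrum (simplices X k) (laplacian cj X d t k)}"

end

theory Submission
  imports Defs "HOL-Library.Function_Algebras"
begin

text \<open>All maxima are governed by the least \<open>c\<^sub>k\<close> with \<open>\<parallel>\<delta>\<^sub>k \<phi>\<parallel>\<^sup>2 \<le> c\<^sub>k \<parallel>\<phi>\<parallel>\<^sup>2\<close>: the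
  up, down and Hodge Laplacians in dimension \<open>k\<close> have maximal eigenvalue \<open>c\<^sub>k\<close>, \<open>c\<^bsub>k-1\<^esub>\<close> and
  \<open>max c\<^sub>k c\<^bsub>k-1\<^esub>\<close>. So everything reduces to \<open>c\<^sub>k \<le> c\<^bsub>k-1\<^esub>\<close> for \<open>k \<ge> 0\<close>.

  Let \<open>i\<^sub>v\<close> be the contraction by the vertex \<open>v\<close>, and let \<open>d\<close> denote the coboundary of the complete
  complex on the \<open>n\<close> vertices. Since \<open>d d = 0\<close> we have \<open>d i\<^sub>v + i\<^sub>v d = 1\<close>, and the sum of the
  \<open>i\<^sub>v\<close> is the adjoint \<open>d\<^sup>*\<close>; hence \<open>\<parallel>d \<phi>\<parallel>\<^sup>2 + \<parallel>d\<^sup>* \<phi>\<parallel>\<^sup>2 = n \<parallel>\<phi>\<parallel>\<^sup>2\<close>. For \<open>\<phi>\<close> supported on the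
  \<open>k\<close>-simplices of \<open>X\<close>, the cochains \<open>i\<^sub>v \<phi>\<close> serve as test functions for \<open>c\<^bsub>k-1\<^esub>\<close>: their squared
  norms add up to \<open>(k + 1) \<parallel>\<phi>\<parallel>\<^sup>2\<close>, and expanding \<open>\<delta> i\<^sub>v \<phi> = \<phi> - i\<^sub>v d \<phi>\<close> shows that
  \<open>\<Sum>\<^sub>v \<parallel>\<delta> i\<^sub>v \<phi>\<parallel>\<^sup>2 = n \<parallel>\<phi>\<parallel>\<^sup>2 - 2 \<parallel>d \<phi>\<parallel>\<^sup>2 + \<Sum>\<^sub>\<rho> f \<rho> \<bar>d \<phi> \<rho>\<bar>\<^sup>2 \<ge> \<Sum>\<^sub>\<rho> (f \<rho> - 1) \<bar>d \<phi> \<rho>\<bar>\<^sup>2\<close>,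
  where \<open>f \<rho>\<close> counts the facets of \<open>\<rho>\<close> that lie in \<open>X\<close>. Now \<open>f \<rho> = k + 2\<close> on \<open>X\<close>, and \<open>d \<phi> \<rho> = 0\<close>
  wherever \<open>f \<rho> = 0\<close>, so the right-hand side is at least \<open>(k + 1) \<parallel>\<delta> \<phi>\<parallel>\<^sup>2\<close>.\<close>

subsection \<open>Linear operators on a finite coordinate space\<close>

text \<open>Supplies span, independence and the exchange bound for functions with pointwise
  operations; each \<open>l2 S\<close> sits inside this one space.\<close>

interpretation fun_space: vector_space "\<lambda>c (\<phi> :: 's \<Rightarrow> 'a::field) x. c * \<phi> x"
  by unfold_locales (auto simp: fun_eq_iff algebra_simps)

lemma sum_fun_apply: "(\<Sum>i\<in>I. f i) x = (\<Sum>i\<in>I. f i x :: 'a::comm_monoid_add)"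
  by (induction I rule: infinite_finite_induct) auto

definition delta :: "'s \<Rightarrow> 's \<Rightarrow> 'a::zero_neq_one" where
  "delta x = (\<lambda>y. if y = x then 1 else 0)"

text \<open>Real-valued, so that norm bounds can be ordered even when the scalars are
  complex.\<close>

definition sqnorm :: "'s set \<Rightarrow> ('s \<Rightarrow> 'a::real_normed_field) \<Rightarrow> real" where
  "sqnorm S \<phi> = (\<Sum>x\<in>S. (norm (\<phi> x))\<^sup>2)"

lemma delta_in_l2: "x \<in> S \<Longrightarrow> delta x \<in> l2 S"
  by (auto simp: delta_def l2_def)

lemma l2_add: "\<phi> \<in> l2 S \<Longrightarrow> \<psi> \<in> l2 S \<Longrightarrow> (\<lambda>x. \<phi> x + \<psi> x :: 'a::monoid_add) \<in> l2 S"
  by (auto simp: l2_def)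

lemma l2_scale: "\<phi> \<in> l2 S \<Longrightarrow> (\<lambda>x. c * \<phi> x :: 'a::mult_zero) \<in> l2 S"
  by (auto simp: l2_def)

lemma zero_in_l2: "(\<lambda>_. 0) \<in> l2 S"
  by (auto simp: l2_def)

lemma sqnorm_nonneg: "0 \<le> sqnorm S \<phi>"
  by (simp add: sqnorm_def sum_nonneg)

lemma sqnorm_eq_0_iff:
  assumes "finite S" "\<phi> \<in> l2 S"
  shows "sqnorm S \<phi> = 0 \<longleftrightarrow> \<phi> = (\<lambda>_. 0)"
  using assms by (auto simp: sqnorm_def sum_nonneg_eq_0_iff l2_def fun_eq_iff)

lemma l2_linear_in_l2: "l2_linear S T A \<Longrightarrow> \<phi> \<in> l2 S \<Longrightarrow> A \<phi> \<in> l2 T"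
  by (simp add: l2_linear_def)

lemma l2_linear_add:
  "l2_linear S T A \<Longrightarrow> \<phi> \<in> l2 S \<Longrightarrow> \<psi> \<in> l2 S \<Longrightarrow> A (\<lambda>x. \<phi> x + \<psi> x) = (\<lambda>y. A \<phi> y + A \<psi> y)"
  by (simp add: l2_linear_def)

lemma l2_linear_scale:
  "l2_linear S T A \<Longrightarrow> \<phi> \<in> l2 S \<Longrightarrow> A (\<lambda>x. c * \<phi> x) = (\<lambda>y. c * A \<phi> y)"
  by (simp add: l2_linear_def)

lemma l2_linear_zero: "l2_linear S T A \<Longrightarrow> A (\<lambda>_. 0) = (\<lambda>_. 0)"
  using l2_linear_scale[OF _ zero_in_l2, of S T A 0] by simp

lemma l2_linear_sum:
  assumes "l2_linear S T A" "finite F" "\<And>x. x \<in> F \<Longrightarrow> f x \<in> l2 S"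
  shows "A (\<lambda>y. \<Sum>x\<in>F. c x * f x y) = (\<lambda>y. \<Sum>x\<in>F. c x * A (f x) y)"
  using assms(2,3)
proof (induction F rule: finite_induct)
  case empty
  then show ?case using l2_linear_zero[OF assms(1)] by simp
next
  case (insert x F)
  have "(\<lambda>y. c x * f x y) \<in> l2 S" "(\<lambda>y. \<Sum>x\<in>F. c x * f x y) \<in> l2 S"
    using insert.prems by (auto simp: l2_def intro!: sum.neutral)
  from l2_linear_add[OF assms(1) this] show ?case
    using insert l2_linear_scale[OF assms(1), of "f x" "c x"] by simp
qed

lemma delta_expansion:
  fixes \<phi> :: "'s \<Rightarrow> 'a::semiring_1"
  assumes "finite S" "\<phi> \<in> l2 S"
  shows "\<phi> = (\<lambda>y. \<Sum>x\<in>S. \<phi> x * delta x y)"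
  using assms by (auto simp: delta_def l2_def fun_eq_iff if_distrib cong: if_cong)

lemma l2_linear_expansion:
  assumes "l2_linear S T A" "finite S" "\<phi> \<in> l2 S"
  shows "A \<phi> = (\<lambda>y. \<Sum>x\<in>S. \<phi> x * A (delta x) y)"
  using l2_linear_sum[OF assms(1,2), of delta \<phi>] delta_expansion[OF assms(2,3)]
  by (metis delta_in_l2)

section \<open>Dimension count in a finite coordinate space\<close>

lemma l2_spanned:
  fixes S :: "'s set"
  assumes "finite S"
  shows "l2 S \<subseteq> fun_space.span (delta ` S :: ('s \<Rightarrow> 'a::field) set)"
proof
  fix \<phi> :: "'s \<Rightarrow> 'a" assume "\<phi> \<in> l2 S"
  then have "\<phi> = (\<lambda>y. \<Sum>x\<in>S. \<phi> x * delta x y)"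
    by (rule delta_expansion[OF assms])
  also have "\<dots> = (\<Sum>x\<in>S. (\<lambda>y. \<phi> x * delta x y))"
    by (simp add: fun_eq_iff sum_fun_apply)
  also have "\<dots> \<in> fun_space.span (delta ` S)"
    by (intro fun_space.span_sum fun_space.span_scale fun_space.span_base) auto
  finally show "\<phi> \<in> fun_space.span (delta ` S)" .
qed

text \<open>The exchange lemma, applied to the spanning set of delta functions.\<close>

lemma independent_in_l2:
  assumes "finite S" "fun_space.independent B" "B \<subseteq> l2 S"
  shows "finite B \<and> card B \<le> card S"
proof -
  have "finite B \<and> card B \<le> card (delta ` S :: ('a \<Rightarrow> 'b) set)"
    using fun_space.independent_span_bound[of "delta ` S" B] assms l2_spanned[of S] by auto
  then show ?thesis using card_image_le[OF assms(1), of "delta :: 'a \<Rightarrow> 'a \<Rightarrow> 'b"] by linarith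
qed

text \<open>Injectivity forces surjectivity by dimension: the images of the delta functions are
  \<open>card S\<close> independent elements, and a function outside their span would enlarge them
  beyond the bound of \<open>independent_in_l2\<close>.\<close>

lemma bij_betw_l2_iff:
  fixes B :: "('s \<Rightarrow> 'a::real_normed_field) \<Rightarrow> 's \<Rightarrow> 'a"
  assumes fin: "finite S" and B: "l2_linear S S B"
  shows "bij_betw B (l2 S) (l2 S) \<longleftrightarrow> (\<forall>\<phi>\<in>l2 S. B \<phi> = (\<lambda>_. 0) \<longrightarrow> \<phi> = (\<lambda>_. 0))"
proof
  assume "bij_betw B (l2 S) (l2 S)"
  then show "\<forall>\<phi>\<in>l2 S. B \<phi> = (\<lambda>_. 0) \<longrightarrow> \<phi> = (\<lambda>_. 0)"
    using zero_in_l2[of S] l2_linear_zero[OF B] by (metis bij_betw_imp_inj_on inj_onD)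
next
  assume ker: "\<forall>\<phi>\<in>l2 S. B \<phi> = (\<lambda>_. 0) \<longrightarrow> \<phi> = (\<lambda>_. 0)"
  have inj: "inj_on B (l2 S)"
  proof (rule inj_onI)
    fix \<phi> \<psi> assume *: "\<phi> \<in> l2 S" "\<psi> \<in> l2 S" "B \<phi> = B \<psi>"
    then have "B (\<lambda>x. \<phi> x + (-1) * \<psi> x) = (\<lambda>_. 0)"
      by (simp only: l2_linear_add[OF B *(1) l2_scale[OF *(2)]] l2_linear_scale[OF B *(2)]) simp
    then have "(\<lambda>x. \<phi> x + (-1) * \<psi> x) = (\<lambda>_. 0)"
      using ker l2_add[OF *(1) l2_scale[OF *(2)]] by blast
    then show "\<phi> = \<psi>" by (simp add: fun_eq_iff)
  qed
  define I where "I = (\<lambda>x. B (delta x)) ` S"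
  have delta_inj: "delta x = (delta y :: 's \<Rightarrow> 'a) \<longleftrightarrow> x = y" for x y
    by (metis delta_def zero_neq_one)
  have inj': "inj_on (\<lambda>x. B (delta x)) S"
    by (rule inj_onI) (metis inj inj_onD delta_in_l2 delta_inj)
  have in_l2: "(\<lambda>y. \<Sum>x\<in>S. c x * delta x y) \<in> l2 S" for c :: "'s \<Rightarrow> 'a"
    by (auto simp: l2_def delta_def intro!: sum.neutral)
  \<comment> \<open>Linear combinations of \<open>I\<close> are values of \<open>B\<close>. This
    gives the independence of \<open>I\<close> now and the preimages for surjectivity at the
    end.\<close>
  have image: "(\<Sum>v\<in>I. (\<lambda>y. f v * v y)) = B (\<lambda>y. \<Sum>x\<in>S. f (B (delta x)) * delta x y)" for f
    using inj' l2_linear_sum[OF B fin, of delta "\<lambda>x. f (B (delta x))"]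
    by (simp add: I_def sum.reindex fun_eq_iff sum_fun_apply delta_in_l2)
  have indep: "fun_space.independent I"
  proof (rule fun_space.independent_if_scalars_zero)
    show "finite I" using fin by (simp add: I_def)
    fix f v assume "(\<Sum>v\<in>I. (\<lambda>y. f v * v y)) = 0" and v: "v \<in> I"
    then have "(\<lambda>y. \<Sum>x\<in>S. f (B (delta x)) * delta x y) = (\<lambda>_. 0)"
      unfolding image using ker in_l2 by (simp add: zero_fun_def)
    then have zero: "(\<Sum>x\<in>S. f (B (delta x)) * delta x z) = 0" for z
      by (rule fun_cong)
    obtain z where z: "z \<in> S" "v = B (delta z)"
      using v by (auto simp: I_def)
    have "(\<Sum>x\<in>S. f (B (delta x)) * delta x z) = f (B (delta z))"
      using fin z(1) by (simp add: delta_def if_distrib cong: if_cong)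
    then show "f v = 0" using zero z(2) by simp
  qed
  have I: "I \<subseteq> l2 S" "card I = card S" "finite I"
    using l2_linear_in_l2[OF B delta_in_l2] inj' fin by (auto simp: I_def card_image)
  have "\<psi> \<in> B ` l2 S" if "\<psi> \<in> l2 S" for \<psi>
  proof -
    have "\<psi> \<in> fun_space.span I"
    proof (rule ccontr)
      assume "\<psi> \<notin> fun_space.span I"
      then have "fun_space.independent (insert \<psi> I)" "\<psi> \<notin> I"
        using indep fun_space.independent_insertI fun_space.span_base by blast+
      then show False using independent_in_l2[OF fin, of "insert \<psi> I"] I that by simp
    qed
    then show ?thesis
      using I(3) in_l2 image by (auto simp: fun_space.span_finite)
  qed
  then show "bij_betw B (l2 S) (l2 S)"
    using inj l2_linear_in_l2[OF B] by (auto simp: bij_betw_def)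
qed

subsection \<open>The largest eigenvalue of a symmetric operator\<close>

text \<open>Common ground of the identity on the reals and \<open>cnj\<close> on the complex
  numbers, so that one argument serves both fields.\<close>

locale scalar_conjugation =
  fixes cj :: "'a::real_normed_field \<Rightarrow> 'a"
  assumes cj_add: "cj (a + b) = cj a + cj b"
    and cj_mult: "cj (a * b) = cj a * cj b"
    and cj_cj: "cj (cj a) = a"
    and cj_of_real: "cj (of_real r) = of_real r"
    and mult_cj: "a * cj a = of_real ((norm a)\<^sup>2)"
begin

abbreviation inner where "inner \<equiv> l2_inner cj"

lemma cj_0: "cj 0 = 0"
  using cj_of_real[of 0] by simp

lemma norm_cj: "norm (cj a) = norm a"
proof (cases "a = 0")
  case False
  have "norm a * norm (cj a) = (norm a)\<^sup>2"
    unfolding norm_mult[symmetric] mult_cj by (simp add: norm_power)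
  then show ?thesis using False by (simp add: power2_eq_square)
qed (simp add: cj_0)

lemma cj_sum: "cj (\<Sum>i\<in>I. f i) = (\<Sum>i\<in>I. cj (f i))"
  by (induction I rule: infinite_finite_induct) (auto simp: cj_0 cj_add)

lemma inner_self: "inner S \<phi> \<phi> = of_real (sqnorm S \<phi>)"
  by (simp add: l2_inner_def sqnorm_def mult_cj)

lemma cj_inner: "cj (inner S \<phi> \<psi>) = inner S \<psi> \<phi>"
  by (simp add: l2_inner_def cj_sum cj_mult cj_cj mult.commute)

lemma inner_add_left: "inner S (\<lambda>x. \<phi> x + \<psi> x) \<chi> = inner S \<phi> \<chi> + inner S \<psi> \<chi>"
  by (simp add: l2_inner_def distrib_right sum.distrib)

lemma inner_add_right: "inner S \<chi> (\<lambda>x. \<phi> x + \<psi> x) = inner S \<chi> \<phi> + inner S \<chi> \<psi>"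
  by (simp add: l2_inner_def cj_add distrib_left sum.distrib)

lemma inner_scale_left: "inner S (\<lambda>x. c * \<phi> x) \<psi> = c * inner S \<phi> \<psi>"
  by (simp add: l2_inner_def sum_distrib_left mult.assoc)

lemma inner_scale_right: "inner S \<phi> (\<lambda>x. c * \<psi> x) = cj c * inner S \<phi> \<psi>"
  by (simp add: l2_inner_def sum_distrib_left cj_mult ac_simps)

lemma inner_zero_left: "inner S (\<lambda>_. 0) \<phi> = 0"
  by (simp add: l2_inner_def)

lemma inner_zero_right: "inner S \<phi> (\<lambda>_. 0) = 0"
  by (simp add: l2_inner_def cj_0)

text \<open>A real inner product makes the two cross terms equal, which leaves a real quadratic
  polynomial in \<open>t\<close>.\<close>

lemma sqnorm_add_scaled:
  assumes "inner S \<phi> \<psi> = of_real r"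
  shows "sqnorm S (\<lambda>x. \<phi> x + of_real t * \<psi> x) = sqnorm S \<phi> + 2 * t * r + t\<^sup>2 * sqnorm S \<psi>"
proof -
  have "inner S \<psi> \<phi> = of_real r"
    using cj_inner[of S \<phi> \<psi>] assms by (simp add: cj_of_real)
  then have "of_real (sqnorm S (\<lambda>x. \<phi> x + of_real t * \<psi> x)) =
      (of_real (sqnorm S \<phi> + 2 * t * r + t\<^sup>2 * sqnorm S \<psi>) :: 'a)"
    unfolding inner_self[symmetric] inner_add_left inner_add_right inner_scale_left inner_scale_right
      cj_of_real
    by (simp add: assms inner_self algebra_simps power2_eq_square)
  then show ?thesis by (simp only: of_real_eq_iff)
qed

text \<open>Crude but sufficient: each product of two values is at most the squared norm, by the
  inequality of arithmetic and geometric means. It controls both an operator and, later, an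
  inverse.\<close>

lemma sesquilinear_bound:
  assumes "finite S"
  shows "norm (\<Sum>x\<in>S. \<Sum>y\<in>S. \<phi> x * cj (\<phi> y) * m x y) \<le> (\<Sum>x\<in>S. \<Sum>y\<in>S. norm (m x y)) * sqnorm S \<phi>"
proof -
  have prod: "norm (\<phi> x) * norm (\<phi> y) \<le> sqnorm S \<phi>" if "x \<in> S" "y \<in> S" for x y
  proof -
    have le: "(norm (\<phi> z))\<^sup>2 \<le> sqnorm S \<phi>" if "z \<in> S" for z
      unfolding sqnorm_def by (rule member_le_sum) (use assms that in auto)
    have "2 * (norm (\<phi> x) * norm (\<phi> y)) \<le> (norm (\<phi> x))\<^sup>2 + (norm (\<phi> y))\<^sup>2"
      using sum_squares_bound[of "norm (\<phi> x)" "norm (\<phi> y)"] by (simp add: mult.assoc)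
    then show ?thesis using le[OF that(1)] le[OF that(2)] by linarith
  qed
  have "norm (\<Sum>x\<in>S. \<Sum>y\<in>S. \<phi> x * cj (\<phi> y) * m x y) \<le>
      (\<Sum>x\<in>S. \<Sum>y\<in>S. norm (\<phi> x * cj (\<phi> y) * m x y))"
    by (intro sum_norm_le) simp
  also have "\<dots> \<le> (\<Sum>x\<in>S. \<Sum>y\<in>S. norm (m x y) * sqnorm S \<phi>)"
  proof (intro sum_mono)
    fix x y assume "x \<in> S" "y \<in> S"
    from mult_left_mono[OF prod[OF this], of "norm (m x y)"]
    show "norm (\<phi> x * cj (\<phi> y) * m x y) \<le> norm (m x y) * sqnorm S \<phi>"
      by (simp add: norm_mult norm_cj mult.commute)
  qed
  finally show ?thesis by (simp add: sum_distrib_right)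
qed

section \<open>Real spectrum of a symmetric operator\<close>

lemma l2_spectrum_iff_eigenvector:
  assumes "finite S" and A: "l2_linear S S A"
  shows "\<mu> \<in> l2_spectrum S A \<longleftrightarrow> (\<exists>\<phi>\<in>l2 S. \<phi> \<noteq> (\<lambda>_. 0) \<and> A \<phi> = (\<lambda>x. \<mu> * \<phi> x))"
proof -
  have "l2_linear S S (\<lambda>\<phi> x. A \<phi> x - \<mu> * \<phi> x)"
    using A unfolding l2_linear_def by (auto simp: l2_def algebra_simps)
  from bij_betw_l2_iff[OF assms(1) this] show ?thesis
    by (auto simp: l2_spectrum_def fun_eq_iff)
qed

text \<open>Eigenvectors for distinct real eigenvalues are orthogonal, hence independent, so there
  are at most \<open>card S\<close> of them. Finiteness gives \<open>Max\<close> its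
  meaning.\<close>

lemma finite_real_spectrum:
  assumes fin: "finite S" and A: "l2_linear S S A"
    and sym: "\<And>\<phi> \<psi>. \<phi> \<in> l2 S \<Longrightarrow> \<psi> \<in> l2 S \<Longrightarrow> inner S (A \<phi>) \<psi> = inner S \<phi> (A \<psi>)"
  shows "finite {x. of_real x \<in> l2_spectrum S A}"
proof -
  define E where "E = {x. of_real x \<in> l2_spectrum S A}"
  have "\<forall>x\<in>E. \<exists>\<phi>. \<phi> \<in> l2 S \<and> \<phi> \<noteq> (\<lambda>_. 0) \<and> A \<phi> = (\<lambda>y. of_real x * \<phi> y)"
    using l2_spectrum_iff_eigenvector[OF fin A] by (auto simp: E_def)
  then obtain v where v: "\<And>x. x \<in> E \<Longrightarrow> v x \<in> l2 S" "\<And>x. x \<in> E \<Longrightarrow> v x \<noteq> (\<lambda>_. 0)"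
    "\<And>x. x \<in> E \<Longrightarrow> A (v x) = (\<lambda>y. of_real x * v x y)"
    by metis
  have orth: "inner S (v x) (v y) = 0" if "x \<in> E" "y \<in> E" "x \<noteq> y" for x y
  proof -
    have "of_real x * inner S (v x) (v y) = of_real y * inner S (v x) (v y)"
      using sym[OF v(1)[OF that(1)] v(1)[OF that(2)]] v(3) that
      by (simp add: inner_scale_left inner_scale_right cj_of_real)
    then show ?thesis using that(3) by simp
  qed
  have self: "inner S (v x) (v x) \<noteq> 0" if "x \<in> E" for x
    using sqnorm_eq_0_iff[OF fin v(1)[OF that]] v(2)[OF that] by (simp add: inner_self)
  have inj: "inj_on v E"
    by (rule inj_onI) (metis orth self)
  \<comment> \<open>Finite subsets only, since \<open>E\<close> is not yet known to be finite; the
    uniform bound on their size then gives finiteness of \<open>E\<close>.\<close>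
  have "fun_space.independent (v ` F)" if "F \<subseteq> E" "finite F" for F
  proof (rule fun_space.independent_if_scalars_zero)
    show "finite (v ` F)" using that by simp
    fix f w assume sum: "(\<Sum>w\<in>v ` F. (\<lambda>y. f w * w y)) = 0" and "w \<in> v ` F"
    then obtain x where x: "x \<in> F" "w = v x" by auto
    have injF: "inj_on v F" using inj that(1) by (rule inj_on_subset)
    have "0 = inner S (\<lambda>y. \<Sum>z\<in>F. f (v z) * v z y) (v x)"
      using sum injF by (simp add: sum.reindex fun_eq_iff sum_fun_apply inner_zero_left)
    also have "\<dots> = (\<Sum>z\<in>F. f (v z) * inner S (v z) (v x))"
      by (subst sum.swap[of _ F S] | simp add: l2_inner_def sum_distrib_left sum_distrib_right mult.assoc)+
    also have "\<dots> = (\<Sum>z\<in>F. if z = x then f (v x) * inner S (v x) (v x) else 0)"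
      by (rule sum.cong) (use orth x that in auto)
    finally show "f w = 0" using self x that by (auto simp: that(2))
  qed
  then have card: "card F \<le> card S" if "F \<subseteq> E" "finite F" for F
    using independent_in_l2[OF fin, of "v ` F"] that v(1) inj
    by (metis card_image image_subset_iff inj_on_subset subset_iff)
  then show ?thesis
    unfolding E_def[symmetric] by (metis finite_if_finite_subsets_card_bdd)
qed

section \<open>Adjoints\<close>

lemma l2_eqI_inner:
  assumes "finite S" "\<chi> \<in> l2 S" "\<xi> \<in> l2 S" "\<And>\<phi>. \<phi> \<in> l2 S \<Longrightarrow> inner S \<phi> \<chi> = inner S \<phi> \<xi>"
  shows "\<chi> = \<xi>"
proof -
  \<comment> \<open>The difference itself is the test function.\<close>
  define \<phi> where "\<phi> = (\<lambda>x. \<chi> x + (- 1) * \<xi> x)"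
  have \<phi>: "\<phi> \<in> l2 S" unfolding \<phi>_def by (intro l2_add l2_scale assms)
  have "cj (- 1) = - 1" using cj_of_real[of "-1"] by simp
  then have "inner S \<phi> \<phi> = 0"
    using assms(4)[OF \<phi>] by (subst (2) \<phi>_def) (simp only: inner_add_right inner_scale_right, simp)
  then have "\<phi> = (\<lambda>_. 0)"
    using sqnorm_eq_0_iff[OF assms(1) \<phi>] by (simp add: inner_self)
  then show ?thesis by (simp add: \<phi>_def fun_eq_iff)
qed

text \<open>The adjoint is given by a description, so linearity comes from uniqueness: both sides
  have the same inner product with every test function.\<close>

lemma l2_linear_adj:
  assumes fin: "finite S" and A: "l2_linear S T A"
  shows "l2_linear T S (l2_adj cj S T A)"
proof -
  note adj = l2_adjoint[OF fin A cj_cj]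
  show ?thesis
    unfolding l2_linear_def
  proof (intro conjI ballI allI)
    show "l2_adj cj S T A \<psi> \<in> l2 S" for \<psi> by (rule adj)
    show "l2_adj cj S T A (\<lambda>x. \<phi> x + \<psi> x) = (\<lambda>y. l2_adj cj S T A \<phi> y + l2_adj cj S T A \<psi> y)" for \<phi> \<psi>
      by (rule l2_eqI_inner[OF fin]) (auto intro!: adj l2_add simp: inner_add_right simp flip: adj(2))
    show "l2_adj cj S T A (\<lambda>x. c * \<phi> x) = (\<lambda>y. c * l2_adj cj S T A \<phi> y)" for c \<phi>
      by (rule l2_eqI_inner[OF fin]) (auto intro!: adj l2_scale simp: inner_scale_right simp flip: adj(2))
  qed
qed

text \<open>An operator and its adjoint have the same norm bounds. Expanding a square replaces the
  Cauchy-Schwarz inequality.\<close>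

lemma adjoint_bound:
  assumes fin: "finite T" and D: "\<And>\<phi>. \<phi> \<in> l2 S \<Longrightarrow> D \<phi> \<in> l2 T" and B: "\<And>\<psi>. \<psi> \<in> l2 T \<Longrightarrow> B \<psi> \<in> l2 S"
    and adj: "\<And>\<phi> \<psi>. \<phi> \<in> l2 S \<Longrightarrow> \<psi> \<in> l2 T \<Longrightarrow> inner T (D \<phi>) \<psi> = inner S \<phi> (B \<psi>)"
    and bound: "\<And>\<phi>. \<phi> \<in> l2 S \<Longrightarrow> sqnorm T (D \<phi>) \<le> c * sqnorm S \<phi>"
    and c: "0 \<le> c" and \<psi>: "\<psi> \<in> l2 T"
  shows "sqnorm S (B \<psi>) \<le> c * sqnorm T \<psi>"
proof -
  have r: "inner T (D (B \<psi>)) \<psi> = of_real (sqnorm S (B \<psi>))"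
    by (simp add: adj B \<psi> inner_self)
  have le: "sqnorm T (D (B \<psi>)) \<le> c * sqnorm S (B \<psi>)"
    by (intro bound B \<psi>)
  show ?thesis
  proof (cases "c = 0")
    case True
    then have "D (B \<psi>) = (\<lambda>_. 0)"
      using le sqnorm_nonneg[of T "D (B \<psi>)"] sqnorm_eq_0_iff[OF fin D[OF B[OF \<psi>]]] by simp
    then show ?thesis using r True by (simp add: inner_zero_left)
  next
    case False
    \<comment> \<open>This is the squared norm of \<open>D (B \<psi>) - c \<psi>\<close>. Bounding
      its first term by \<open>c * sqnorm S (B \<psi>)\<close> leaves the claim multiplied by
      \<open>c\<close>, whence the separate case \<open>c = 0\<close>.\<close>
    have "0 \<le> sqnorm T (D (B \<psi>)) + 2 * (- c) * sqnorm S (B \<psi>) + (- c)\<^sup>2 * sqnorm T \<psi>"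
      unfolding sqnorm_add_scaled[OF r, symmetric] by (rule sqnorm_nonneg)
    then have "c * sqnorm S (B \<psi>) \<le> c * (c * sqnorm T \<psi>)"
      using le by (simp add: power2_eq_square)
    then show ?thesis using c False by simp
  qed
qed

end

section \<open>Variational description of the largest eigenvalue\<close>

locale symmetric_operator = scalar_conjugation cj
  for cj :: "'a::real_normed_field \<Rightarrow> 'a" +
  fixes S :: "'s set" and A :: "('s \<Rightarrow> 'a) \<Rightarrow> 's \<Rightarrow> 'a" and q :: "('s \<Rightarrow> 'a) \<Rightarrow> real"
  assumes fin: "finite S" and nonempty: "S \<noteq> {}"
    and linear: "l2_linear S S A"
    and symmetric: "\<phi> \<in> l2 S \<Longrightarrow> \<psi> \<in> l2 S \<Longrightarrow> inner S (A \<phi>) \<psi> = inner S \<phi> (A \<psi>)"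
    and form: "\<phi> \<in> l2 S \<Longrightarrow> inner S (A \<phi>) \<phi> = of_real (q \<phi>)"
begin

lemma form_bounded: "\<exists>b. \<forall>\<phi>\<in>l2 S. q \<phi> \<le> b * sqnorm S \<phi>"
proof -
  define b where "b = (\<Sum>x\<in>S. \<Sum>y\<in>S. norm (A (delta x) y))"
  have "q \<phi> \<le> b * sqnorm S \<phi>" if "\<phi> \<in> l2 S" for \<phi>
  proof -
    have "inner S (A \<phi>) \<phi> = (\<Sum>y\<in>S. (\<Sum>x\<in>S. \<phi> x * A (delta x) y) * cj (\<phi> y))"
      by (subst l2_linear_expansion[OF linear fin that]) (simp add: l2_inner_def)
    also have "\<dots> = (\<Sum>x\<in>S. \<Sum>y\<in>S. \<phi> x * cj (\<phi> y) * A (delta x) y)"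
      by (subst sum.swap) (simp add: sum_distrib_left sum_distrib_right ac_simps)
    finally have "norm (of_real (q \<phi>) :: 'a) \<le> b * sqnorm S \<phi>"
      using sesquilinear_bound[OF fin, of \<phi> "\<lambda>x. A (delta x)"] form[OF that] by (simp add: b_def)
    then show ?thesis by simp
  qed
  then show ?thesis by blast
qed

lemma eigenvalue_le:
  assumes "\<forall>\<phi>\<in>l2 S. q \<phi> \<le> b * sqnorm S \<phi>" and "of_real x \<in> l2_spectrum S A"
  shows "x \<le> b"
proof -
  obtain \<phi> where \<phi>: "\<phi> \<in> l2 S" "\<phi> \<noteq> (\<lambda>_. 0)" "A \<phi> = (\<lambda>y. of_real x * \<phi> y)"
    using assms(2) l2_spectrum_iff_eigenvector[OF fin linear] by auto
  have "of_real (q \<phi>) = (of_real (x * sqnorm S \<phi>) :: 'a)"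
    using form[OF \<phi>(1)] \<phi>(3) by (simp add: inner_scale_left inner_self)
  then have "x * sqnorm S \<phi> \<le> b * sqnorm S \<phi>"
    using assms(1) \<phi>(1) by (metis of_real_eq_iff)
  moreover have "sqnorm S \<phi> > 0"
    using sqnorm_eq_0_iff[OF fin \<phi>(1)] sqnorm_nonneg[of S \<phi>] \<phi>(2) by linarith
  ultimately show ?thesis by simp
qed

text \<open>If \<open>m\<close> bounds the form but is not an eigenvalue, then \<open>m - A\<close> is positive semidefinite and
  invertible, hence bounded below by a positive constant, and a smaller \<open>m\<close> would do.\<close>

lemma form_bound_improvable:
  assumes le: "\<forall>\<phi>\<in>l2 S. q \<phi> \<le> m * sqnorm S \<phi>" and not: "of_real m \<notin> l2_spectrum S A"
  shows "\<exists>e>0. \<forall>\<phi>\<in>l2 S. q \<phi> \<le> (m - e) * sqnorm S \<phi>"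
proof -
  define C where "C \<phi> = (\<lambda>x. A \<phi> x - of_real m * \<phi> x)" for \<phi>
  have C: "l2_linear S S C"
    using linear unfolding l2_linear_def C_def by (auto simp: l2_def algebra_simps)
  have "bij_betw C (l2 S) (l2 S)"
    using not by (simp add: l2_spectrum_def C_def[abs_def])
  then have "\<forall>x\<in>S. \<exists>\<phi>\<in>l2 S. C \<phi> = delta x"
    using delta_in_l2 by (metis bij_betw_imp_surj_on imageE)
  then obtain g where g: "\<And>x. x \<in> S \<Longrightarrow> g x \<in> l2 S" "\<And>x. x \<in> S \<Longrightarrow> C (g x) = delta x"
    by metis
  \<comment> \<open>The inverse of \<open>C\<close>, assembled from preimages of the delta functions
    so that it has explicit matrix entries \<open>g x y\<close>.\<close>
  define L where "L \<phi> = (\<lambda>y. \<Sum>x\<in>S. \<phi> x * g x y)" for \<phi> :: "'s \<Rightarrow> 'a"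
  have L: "L \<phi> \<in> l2 S" for \<phi>
    using g(1) by (auto simp: L_def l2_def intro!: sum.neutral)
  have CL: "C (L \<phi>) = \<phi>" if "\<phi> \<in> l2 S" for \<phi>
  proof -
    have "C (L \<phi>) = (\<lambda>y. \<Sum>x\<in>S. \<phi> x * C (g x) y)"
      unfolding L_def by (rule l2_linear_sum[OF C fin g(1)])
    also have "\<dots> = (\<lambda>y. \<Sum>x\<in>S. \<phi> x * delta x y)"
      using g(2) by simp
    finally show ?thesis using delta_expansion[OF fin that] by simp
  qed
  \<comment> \<open>Bounds the form of the inverse; the summand 1 makes \<open>1 / b\<close>
    meaningful.\<close>
  define b where "b = 1 + (\<Sum>x\<in>S. \<Sum>y\<in>S. norm (g x y))"
  have b: "b > 0"
    by (simp add: b_def add_pos_nonneg sum_nonneg)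
  have innerC: "inner S (C \<phi>) \<psi> = inner S (A \<phi>) \<psi> - of_real m * inner S \<phi> \<psi>" for \<phi> \<psi>
    by (simp add: C_def l2_inner_def left_diff_distrib sum_subtractf sum_distrib_left mult.assoc)
  have C_form: "inner S (C \<phi>) \<phi> = of_real (q \<phi> - m * sqnorm S \<phi>)" if "\<phi> \<in> l2 S" for \<phi>
    by (simp add: innerC form[OF that] inner_self)
  have C_sym: "inner S (C \<phi>) \<psi> = inner S \<phi> (C \<psi>)" if "\<phi> \<in> l2 S" "\<psi> \<in> l2 S" for \<phi> \<psi>
    using innerC[of \<psi> \<phi>] innerC[of \<phi> \<psi>] symmetric[OF that]
      cj_inner[of S "C \<psi>" \<phi>] cj_inner[of S "A \<psi>" \<phi>] cj_inner[of S \<psi> \<phi>]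
      arg_cong[OF innerC[of \<psi> \<phi>], of cj] cj_add[of "inner S (C \<psi>) \<phi>" "of_real m * inner S \<psi> \<phi>"]
    by (simp add: cj_mult cj_of_real)
  have "q \<phi> \<le> (m - 1 / b) * sqnorm S \<phi>" if \<phi>: "\<phi> \<in> l2 S" for \<phi>
  proof -
    define t where "t = 1 / b"
    define \<psi> where "\<psi> = L \<phi>"
    define p where "p = q \<psi> - m * sqnorm S \<psi>"
    have p: "inner S \<phi> \<psi> = of_real p"
      using C_form[OF L, of \<phi>] CL[OF \<phi>] by (simp add: p_def \<psi>_def)
    have "inner S \<psi> \<phi> = (\<Sum>y\<in>S. (\<Sum>x\<in>S. \<phi> x * g x y) * cj (\<phi> y))"
      by (simp add: \<psi>_def L_def l2_inner_def)
    also have "\<dots> = (\<Sum>x\<in>S. \<Sum>y\<in>S. \<phi> x * cj (\<phi> y) * g x y)"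
      by (subst sum.swap) (simp add: sum_distrib_left sum_distrib_right ac_simps)
    finally have "norm (inner S \<psi> \<phi>) \<le> (b - 1) * sqnorm S \<phi>"
      using sesquilinear_bound[OF fin, of \<phi> g] by (simp add: b_def)
    moreover have "norm (inner S \<psi> \<phi>) = \<bar>p\<bar>"
      by (metis cj_inner norm_cj p norm_of_real)
    ultimately have "\<bar>p\<bar> \<le> (b - 1) * sqnorm S \<phi>" by simp
    then have "- p \<le> b * sqnorm S \<phi>"
      using sqnorm_nonneg[of S \<phi>] by (simp add: left_diff_distrib)
    from mult_left_mono[OF this, of "t\<^sup>2"] have tp: "- (t\<^sup>2 * p) \<le> t * sqnorm S \<phi>"
      using b by (simp add: t_def power2_eq_square field_simps)
    \<comment> \<open>Since \<open>C \<psi> = \<phi>\<close>, the form of \<open>C\<close> at \<chi>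
      is its form at \<phi> plus \<open>2 * t * sqnorm S \<phi> + t\<^sup>2 * p\<close>. It is
      nonpositive, and for \<open>t = 1 / b\<close> the last term costs at most one of the two
      copies of \<open>t * sqnorm S \<phi>\<close>.\<close>
    define \<chi> where "\<chi> = (\<lambda>x. \<phi> x + of_real t * \<psi> x)"
    have \<psi>: "\<psi> \<in> l2 S" by (simp add: \<psi>_def L)
    have \<chi>: "\<chi> \<in> l2 S" unfolding \<chi>_def by (intro l2_add l2_scale \<phi> \<psi>)
    have "C \<chi> = (\<lambda>x. C \<phi> x + of_real t * \<phi> x)"
      unfolding \<chi>_def l2_linear_add[OF C \<phi> l2_scale[OF \<psi>]] l2_linear_scale[OF C \<psi>]
      using CL[OF \<phi>] by (simp add: \<psi>_def)
    then have "inner S (C \<chi>) \<chi> =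
        inner S (C \<phi>) \<phi> + of_real t * inner S (C \<phi>) \<psi> + of_real t * inner S \<phi> \<phi>
        + of_real (t\<^sup>2) * inner S \<phi> \<psi>"
      by (simp add: \<chi>_def inner_add_left inner_add_right inner_scale_left inner_scale_right cj_of_real
          algebra_simps power2_eq_square)
    moreover have "inner S (C \<phi>) \<psi> = of_real (sqnorm S \<phi>)"
      using C_sym[OF \<phi> \<psi>] CL[OF \<phi>] by (simp add: \<psi>_def inner_self)
    ultimately have "of_real (q \<chi> - m * sqnorm S \<chi>) =
        (of_real (q \<phi> - m * sqnorm S \<phi> + 2 * (t * sqnorm S \<phi>) + t\<^sup>2 * p) :: 'a)"
      by (simp add: C_form[OF \<phi>] C_form[OF \<chi>] p inner_self)
    then have "q \<chi> - m * sqnorm S \<chi> = q \<phi> - m * sqnorm S \<phi> + 2 * (t * sqnorm S \<phi>) + t\<^sup>2 * p"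
      by (simp only: of_real_eq_iff)
    then have "q \<phi> - m * sqnorm S \<phi> + t * sqnorm S \<phi> \<le> 0"
      using le \<chi> tp by force
    then show ?thesis by (simp add: t_def left_diff_distrib)
  qed
  then show ?thesis using b by (intro exI[of _ "1 / b"]) auto
qed

text \<open>The maximum is the infimum of all bounds \<open>b\<close> on the form. That infimum is
  itself a bound, and it is an eigenvalue because otherwise \<open>form_bound_improvable\<close>
  would lower it.\<close>

lemma max_spectrum:
  defines "m \<equiv> Max {x. of_real x \<in> l2_spectrum S A}"
  shows max_eigenvector: "\<exists>\<phi>\<in>l2 S. \<phi> \<noteq> (\<lambda>_. 0) \<and> A \<phi> = (\<lambda>x. of_real m * \<phi> x)"
    and form_le_max: "\<And>\<phi>. \<phi> \<in> l2 S \<Longrightarrow> q \<phi> \<le> m * sqnorm S \<phi>"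
proof -
  define B where "B = {b. \<forall>\<phi>\<in>l2 S. q \<phi> \<le> b * sqnorm S \<phi>}"
  obtain z where z: "z \<in> S" using nonempty by auto
  define e :: "'s \<Rightarrow> 'a" where "e = delta z"
  have e: "e \<in> l2 S" "e \<noteq> (\<lambda>_. 0)"
    using delta_in_l2[OF z] by (auto simp: e_def delta_def fun_eq_iff)
  then have pos: "sqnorm S e > 0"
    using sqnorm_eq_0_iff[OF fin e(1)] sqnorm_nonneg[of S e] by linarith
  have B: "B \<noteq> {}" using form_bounded by (auto simp: B_def)
  \<comment> \<open>The Rayleigh quotient of a single delta function is a lower bound.\<close>
  have "bdd_below B"
  proof (rule bdd_belowI)
    fix b assume "b \<in> B"
    then show "q e / sqnorm S e \<le> b"
      using pos e(1) by (simp add: B_def pos_divide_le_eq)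
  qed
  have Inf_in: "\<forall>\<phi>\<in>l2 S. q \<phi> \<le> Inf B * sqnorm S \<phi>"
  proof
    fix \<phi> :: "'s \<Rightarrow> 'a" assume \<phi>: "\<phi> \<in> l2 S"
    show "q \<phi> \<le> Inf B * sqnorm S \<phi>"
    proof (cases "sqnorm S \<phi> = 0")
      \<comment> \<open>Here \<open>b\<close> drops out of the inequality, so any member of
        \<open>B\<close> yields it.\<close>
      case True
      then show ?thesis using B \<phi> by (auto simp: B_def)
    next
      case False
      then have pos: "sqnorm S \<phi> > 0" using sqnorm_nonneg[of S \<phi>] by linarith
      have "q \<phi> / sqnorm S \<phi> \<le> Inf B"
        using B by (rule cInf_greatest) (use \<phi> pos in \<open>auto simp: B_def divide_le_eq\<close>)
      then show ?thesis using pos by (simp add: divide_le_eq)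
    qed
  qed
  have Inf_spec: "of_real (Inf B) \<in> l2_spectrum S A"
  proof (rule ccontr)
    assume "\<not> ?thesis"
    then obtain e where "e > 0" "Inf B - e \<in> B"
      using form_bound_improvable[OF Inf_in] by (auto simp: B_def)
    then show False using cInf_lower[OF _ \<open>bdd_below B\<close>] by fastforce
  qed
  have "m = Inf B"
    unfolding m_def
    by (rule Max_eqI) (use finite_real_spectrum[OF fin linear symmetric] eigenvalue_le[OF Inf_in] Inf_spec in auto)
  then show "\<exists>\<phi>\<in>l2 S. \<phi> \<noteq> (\<lambda>_. 0) \<and> A \<phi> = (\<lambda>x. of_real m * \<phi> x)"
    and "\<And>\<phi>. \<phi> \<in> l2 S \<Longrightarrow> q \<phi> \<le> m * sqnorm S \<phi>"
    using Inf_in Inf_spec l2_spectrum_iff_eigenvector[OF fin linear] by auto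
qed

end

subsection \<open>Contractions in the complete complex\<close>

text \<open>The complete complex in coordinates: \<open>s\<close> holds the incidence numbers, and
  \<open>diamond\<close> is one matrix entry of \<open>d d = 0\<close>, where exactly two simplices
  lie between the smaller and the larger one.\<close>

locale incidence = scalar_conjugation cj
  for cj :: "'a::real_normed_field \<Rightarrow> 'a" +
  fixes V :: "'v set" and s :: "'v set \<Rightarrow> 'v set \<Rightarrow> 'a"
  assumes finite_V: "finite V"
    and sign: "\<tau> \<subseteq> V \<Longrightarrow> v \<in> V - \<tau> \<Longrightarrow> s \<tau> (insert v \<tau>) \<in> {1, -1}"
    and diamond: "\<tau> \<subseteq> V \<Longrightarrow> u \<in> V - \<tau> \<Longrightarrow> v \<in> V - \<tau> \<Longrightarrow> u \<noteq> v \<Longrightarrow>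
      s \<tau> (insert u \<tau>) * s (insert u \<tau>) (insert v (insert u \<tau>))
      + s \<tau> (insert v \<tau>) * s (insert v \<tau>) (insert v (insert u \<tau>)) = 0"
begin

text \<open>One formula for all dimensions and all functions; the complex \<open>X\<close> enters
  only through supports and through the faces over which norms are taken.\<close>

definition cobd :: "('v set \<Rightarrow> 'a) \<Rightarrow> 'v set \<Rightarrow> 'a" where
  "cobd \<phi> \<sigma> = (\<Sum>v\<in>\<sigma>. s (\<sigma> - {v}) \<sigma> * \<phi> (\<sigma> - {v}))"

definition contract :: "'v \<Rightarrow> ('v set \<Rightarrow> 'a) \<Rightarrow> 'v set \<Rightarrow> 'a" where
  "contract v \<phi> \<tau> = (if v \<in> \<tau> then 0 else s \<tau> (insert v \<tau>) * \<phi> (insert v \<tau>))"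

definition bd :: "('v set \<Rightarrow> 'a) \<Rightarrow> 'v set \<Rightarrow> 'a" where
  "bd \<phi> \<tau> = (\<Sum>v\<in>V. contract v \<phi> \<tau>)"

text \<open>Indexed by cardinality: \<open>layer m\<close> consists of the simplices of dimension
  \<open>m - 1\<close>.\<close>

definition layer :: "nat \<Rightarrow> 'v set set" where
  "layer m = {\<sigma>. \<sigma> \<subseteq> V \<and> card \<sigma> = m}"

lemma finite_layer: "finite (layer m)"
  using finite_V by (simp add: layer_def)

lemma sign_square: "\<tau> \<subseteq> V \<Longrightarrow> v \<in> V - \<tau> \<Longrightarrow> s \<tau> (insert v \<tau>) * s \<tau> (insert v \<tau>) = 1"
  using sign[of \<tau> v] by auto

lemma cj_sign: "\<tau> \<subseteq> V \<Longrightarrow> v \<in> V - \<tau> \<Longrightarrow> cj (s \<tau> (insert v \<tau>)) = s \<tau> (insert v \<tau>)"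
  using sign[of \<tau> v] cj_of_real[of 1] cj_of_real[of "-1"] by auto

lemma norm_sign: "\<tau> \<subseteq> V \<Longrightarrow> v \<in> V - \<tau> \<Longrightarrow> norm (s \<tau> (insert v \<tau>)) = 1"
  using sign[of \<tau> v] by auto

lemma bd_eq: "bd \<phi> \<tau> = (\<Sum>v\<in>V - \<tau>. s \<tau> (insert v \<tau>) * \<phi> (insert v \<tau>))"
  unfolding bd_def using finite_V by (intro sum.mono_neutral_cong_right) (auto simp: contract_def)

text \<open>Double counting of pairs of a simplex and one of its facets, via the bijection that
  sends \<open>(\<tau>, v)\<close> to \<open>(insert v \<tau>, v)\<close>.\<close>

lemma sum_layer_swap:
  fixes g :: "'v \<Rightarrow> 'v set \<Rightarrow> 'v set \<Rightarrow> 'b::comm_monoid_add"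
  shows "(\<Sum>\<tau>\<in>layer m. \<Sum>v\<in>V - \<tau>. g v \<tau> (insert v \<tau>)) = (\<Sum>\<sigma>\<in>layer (Suc m). \<Sum>v\<in>\<sigma>. g v (\<sigma> - {v}) \<sigma>)"
proof -
  have fin: "finite \<sigma>" if "\<sigma> \<in> layer n" for \<sigma> n
    using that finite_V finite_subset by (auto simp: layer_def)
  have "(\<Sum>\<tau>\<in>layer m. \<Sum>v\<in>V - \<tau>. g v \<tau> (insert v \<tau>)) =
      (\<Sum>(\<tau>, v)\<in>(SIGMA \<tau>:layer m. V - \<tau>). g v \<tau> (insert v \<tau>))"
    using finite_layer finite_V by (intro sum.Sigma) auto
  also have "\<dots> = (\<Sum>(\<sigma>, v)\<in>(SIGMA \<sigma>:layer (Suc m). \<sigma>). g v (\<sigma> - {v}) \<sigma>)"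
    by (rule sum.reindex_bij_witness[of _ "\<lambda>(\<sigma>, v). (\<sigma> - {v}, v)" "\<lambda>(\<tau>, v). (insert v \<tau>, v)"])
      (auto simp: layer_def insert_Diff finite_subset[OF _ finite_V])
  also have "\<dots> = (\<Sum>\<sigma>\<in>layer (Suc m). \<Sum>v\<in>\<sigma>. g v (\<sigma> - {v}) \<sigma>)"
    using finite_layer fin by (intro sum.Sigma[symmetric]) auto
  finally show ?thesis .
qed

text \<open>Adjointness is the double count of \<open>sum_layer_swap\<close>; the signs are fixed by
  conjugation.\<close>

lemma inner_cobd:
  "inner (layer (Suc m)) (cobd \<phi>) \<psi> = inner (layer m) \<phi> (bd \<psi>)"
proof -
  have "inner (layer m) \<phi> (bd \<psi>) =
      (\<Sum>\<tau>\<in>layer m. \<Sum>v\<in>V - \<tau>. \<phi> \<tau> * (s \<tau> (insert v \<tau>) * cj (\<psi> (insert v \<tau>))))"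
    unfolding l2_inner_def bd_eq
    by (intro sum.cong refl) (auto simp: cj_sum cj_mult sum_distrib_left cj_sign layer_def)
  also have "\<dots> = (\<Sum>\<sigma>\<in>layer (Suc m). \<Sum>v\<in>\<sigma>. \<phi> (\<sigma> - {v}) * (s (\<sigma> - {v}) \<sigma> * cj (\<psi> \<sigma>)))"
    by (rule sum_layer_swap)
  finally show ?thesis
    by (simp add: l2_inner_def cobd_def sum_distrib_left sum_distrib_right ac_simps)
qed

text \<open>The homotopy formula for the cone with apex \<open>v\<close>. If \<open>v\<close> is in
  \<sigma>, only the facet opposite to \<open>v\<close> survives. Otherwise that facet of
  \<open>insert v \<sigma>\<close> contributes \<phi> at \<sigma>, and the remaining terms cancel by
  \<open>diamond\<close>.\<close>

lemma cobd_contract: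
  assumes "\<sigma> \<subseteq> V" and "v \<in> V"
  shows "cobd (contract v \<phi>) \<sigma> + contract v (cobd \<phi>) \<sigma> = \<phi> \<sigma>"
proof (cases "v \<in> \<sigma>")
  case True
  have fin: "finite \<sigma>" using assms finite_V finite_subset by blast
  have "cobd (contract v \<phi>) \<sigma> =
      (\<Sum>u\<in>\<sigma>. if u = v then s (\<sigma> - {v}) \<sigma> * (s (\<sigma> - {v}) \<sigma> * \<phi> \<sigma>) else 0)"
    unfolding cobd_def using True by (intro sum.cong) (auto simp: contract_def insert_absorb)
  also have "\<dots> = (s (\<sigma> - {v}) \<sigma> * s (\<sigma> - {v}) \<sigma>) * \<phi> \<sigma>"
    using True fin by (simp add: mult.assoc)
  also have "\<dots> = \<phi> \<sigma>"
    using sign_square[of "\<sigma> - {v}" v] True assms by (auto simp: insert_absorb)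
  finally show ?thesis using True by (simp add: contract_def)
next
  case False
  have fin: "finite \<sigma>" using assms finite_V finite_subset by blast
  have "contract v (cobd \<phi>) \<sigma> = s \<sigma> (insert v \<sigma>) * (s \<sigma> (insert v \<sigma>) * \<phi> \<sigma>
      + (\<Sum>u\<in>\<sigma>. s (insert v \<sigma> - {u}) (insert v \<sigma>) * \<phi> (insert v \<sigma> - {u})))"
    using False fin by (simp add: contract_def cobd_def)
  also have "\<dots> = \<phi> \<sigma> + (\<Sum>u\<in>\<sigma>. s \<sigma> (insert v \<sigma>) *
      (s (insert v \<sigma> - {u}) (insert v \<sigma>) * \<phi> (insert v \<sigma> - {u})))"
    using sign_square[of \<sigma> v] False assms
    by (simp add: distrib_left sum_distrib_left mult.assoc[symmetric])
  also have "(\<Sum>u\<in>\<sigma>. s \<sigma> (insert v \<sigma>) *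
      (s (insert v \<sigma> - {u}) (insert v \<sigma>) * \<phi> (insert v \<sigma> - {u}))) = - cobd (contract v \<phi>) \<sigma>"
    unfolding cobd_def sum_negf[symmetric]
  proof (rule sum.cong[OF refl])
    fix u assume u: "u \<in> \<sigma>"
    define \<tau> where "\<tau> = \<sigma> - {u}"
    have \<tau>: "\<tau> \<subseteq> V" "u \<in> V - \<tau>" "v \<in> V - \<tau>" "u \<noteq> v" "\<sigma> = insert u \<tau>" "insert v \<sigma> - {u} = insert v \<tau>"
      using u assms False by (auto simp: \<tau>_def)
    define a b c e where "a = s \<tau> (insert u \<tau>)" and "b = s (insert u \<tau>) (insert v (insert u \<tau>))"
      and "c = s \<tau> (insert v \<tau>)" and "e = s (insert v \<tau>) (insert v (insert u \<tau>))"
    have sum0: "a * b + c * e = 0"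
      using diamond[OF \<tau>(1-4)] by (simp add: a_def b_def c_def e_def)
    have pm: "a \<in> {1, -1}" "b \<in> {1, -1}" "c \<in> {1, -1}"
      using sign[of \<tau> u] sign[of "insert u \<tau>" v] sign[of \<tau> v] \<tau> by (auto simp: a_def b_def c_def)
    \<comment> \<open>Solves \<open>a * b + c * e = 0\<close> for \<open>b * e\<close>, using that
      squares of signs are 1.\<close>
    have "b * e = (c * c) * (b * e)" using pm(3) by auto
    also have "\<dots> = b * c * (c * e)" by (simp add: ac_simps)
    also have "c * e = - (a * b)" using sum0 by (metis add.commute eq_neg_iff_add_eq_0)
    also have "b * c * - (a * b) = - (a * c * (b * b))" by (simp add: ac_simps)
    also have "b * b = 1" using pm(2) by auto
    finally have be: "b * e = - (a * c)" by simp
    have "contract v \<phi> (\<sigma> - {u}) = c * \<phi> (insert v \<tau>)"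
      using \<tau>(3) by (simp add: contract_def c_def flip: \<tau>_def)
    moreover have "s (\<sigma> - {u}) \<sigma> = a" "s \<sigma> (insert v \<sigma>) = b"
      by (simp_all only: a_def b_def \<tau>(5)[symmetric] \<tau>_def[symmetric])
    moreover have "s (insert v \<sigma> - {u}) (insert v \<sigma>) = e"
      by (simp only: e_def \<tau>(6) \<tau>(5)[symmetric])
    ultimately show "s \<sigma> (insert v \<sigma>) * (s (insert v \<sigma> - {u}) (insert v \<sigma>) * \<phi> (insert v \<sigma> - {u})) =
        - (s (\<sigma> - {u}) \<sigma> * contract v \<phi> (\<sigma> - {u}))"
      using be by (simp add: \<tau>(6) flip: mult.assoc)
  qed
  finally show ?thesis by simp
qed

text \<open>The homotopy formula summed over all vertices.\<close>

lemma laplacian_identity: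
  assumes "\<sigma> \<subseteq> V"
  shows "cobd (bd \<phi>) \<sigma> + bd (cobd \<phi>) \<sigma> = of_nat (card V) * \<phi> \<sigma>"
proof -
  have "cobd (bd \<phi>) \<sigma> = (\<Sum>v\<in>V. cobd (contract v \<phi>) \<sigma>)"
    unfolding cobd_def bd_def sum_distrib_left by (rule sum.swap)
  then have "cobd (bd \<phi>) \<sigma> + bd (cobd \<phi>) \<sigma> = (\<Sum>v\<in>V. cobd (contract v \<phi>) \<sigma> + contract v (cobd \<phi>) \<sigma>)"
    by (simp add: bd_def sum.distrib)
  then show ?thesis using cobd_contract[OF assms] by simp
qed

text \<open>Pair \<open>laplacian_identity\<close> with \<phi> and drop the squared norm of
  \<open>bd \<phi>\<close>.\<close>

lemma sqnorm_cobd_le: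
  "sqnorm (layer (Suc (Suc j))) (cobd \<phi>) \<le> card V * sqnorm (layer (Suc j)) \<phi>"
proof -
  have "of_nat (card V) * inner (layer (Suc j)) \<phi> \<phi> =
      inner (layer (Suc j)) (\<lambda>\<sigma>. cobd (bd \<phi>) \<sigma> + bd (cobd \<phi>) \<sigma>) \<phi>"
    unfolding inner_scale_left[symmetric]
    by (simp add: l2_inner_def laplacian_identity layer_def)
  also have "\<dots> = inner (layer j) (bd \<phi>) (bd \<phi>) + inner (layer (Suc (Suc j))) (cobd \<phi>) (cobd \<phi>)"
    using inner_cobd[of j "bd \<phi>" \<phi>] inner_cobd[of "Suc j" \<phi> "cobd \<phi>"]
      cj_inner[of "layer (Suc j)" \<phi> "bd (cobd \<phi>)"] cj_inner[of "layer (Suc (Suc j))" "cobd \<phi>" "cobd \<phi>"]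
    by (simp add: inner_add_left)
  finally have "of_real (card V * sqnorm (layer (Suc j)) \<phi>) =
      (of_real (sqnorm (layer j) (bd \<phi>) + sqnorm (layer (Suc (Suc j))) (cobd \<phi>)) :: 'a)"
    by (simp add: inner_self)
  then show ?thesis
    using sqnorm_nonneg[of "layer j" "bd \<phi>"] by (simp only: of_real_eq_iff)
qed

section \<open>Norm estimates on a subcomplex\<close>

lemma faces_subset_layer: "simplicial_complex V X \<Longrightarrow> {\<sigma> \<in> X. card \<sigma> = m} \<subseteq> layer m"
  by (auto simp: simplicial_complex_def layer_def)

lemma sqnorm_subset_support:
  assumes "\<phi> \<in> l2 F" "F \<subseteq> G" "finite G"
  shows "sqnorm G \<phi> = sqnorm F \<phi>"
  unfolding sqnorm_def using assms by (intro sum.mono_neutral_right) (auto simp: l2_def)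

text \<open>After enlarging to the whole layer, each value of \<phi> is counted once for every
  vertex of its simplex.\<close>

lemma sum_sqnorm_contract_le:
  assumes X: "simplicial_complex V X" and \<phi>: "\<phi> \<in> l2 {\<sigma> \<in> X. card \<sigma> = Suc j}"
  shows "(\<Sum>v\<in>V. sqnorm {\<sigma> \<in> X. card \<sigma> = j} (contract v \<phi>)) \<le>
    Suc j * sqnorm {\<sigma> \<in> X. card \<sigma> = Suc j} \<phi>"
proof -
  have "(\<Sum>v\<in>V. sqnorm {\<sigma> \<in> X. card \<sigma> = j} (contract v \<phi>)) \<le> (\<Sum>v\<in>V. sqnorm (layer j) (contract v \<phi>))"
    unfolding sqnorm_def by (intro sum_mono sum_mono2 finite_layer faces_subset_layer[OF X]) auto
  also have "\<dots> = (\<Sum>\<tau>\<in>layer j. \<Sum>v\<in>V. (norm (contract v \<phi> \<tau>))\<^sup>2)"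
    unfolding sqnorm_def by (rule sum.swap)
  also have "\<dots> = (\<Sum>\<tau>\<in>layer j. \<Sum>v\<in>V - \<tau>. (norm (\<phi> (insert v \<tau>)))\<^sup>2)"
    using finite_V by (intro sum.cong refl sum.mono_neutral_cong_right)
      (auto simp: contract_def norm_mult norm_sign layer_def)
  also have "\<dots> = (\<Sum>\<sigma>\<in>layer (Suc j). \<Sum>v\<in>\<sigma>. (norm (\<phi> \<sigma>))\<^sup>2)"
    by (rule sum_layer_swap)
  also have "\<dots> = Suc j * sqnorm (layer (Suc j)) \<phi>"
    by (simp add: layer_def sqnorm_def sum_distrib_left)
  also have "sqnorm (layer (Suc j)) \<phi> = sqnorm {\<sigma> \<in> X. card \<sigma> = Suc j} \<phi>"
    by (rule sqnorm_subset_support[OF \<phi> faces_subset_layer[OF X] finite_layer])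
  finally show ?thesis .
qed

text \<open>Each value of \<omega> is counted once for every facet of its simplex in
  \<open>X\<close>: this is the weight \<open>f \<rho>\<close> of the overview, kept as a sum of
  indicators.\<close>

lemma sum_sqnorm_contract_cobd:
  assumes X: "simplicial_complex V X"
  shows "(\<Sum>v\<in>V. sqnorm {\<sigma> \<in> X. card \<sigma> = m} (contract v \<omega>)) =
    (\<Sum>\<rho>\<in>layer (Suc m). \<Sum>v\<in>\<rho>. if \<rho> - {v} \<in> X then (norm (\<omega> \<rho>))\<^sup>2 else 0)"
proof -
  have "(\<Sum>v\<in>V. sqnorm {\<sigma> \<in> X. card \<sigma> = m} (contract v \<omega>)) =
      (\<Sum>\<sigma>\<in>{\<sigma> \<in> X. card \<sigma> = m}. \<Sum>v\<in>V. (norm (contract v \<omega> \<sigma>))\<^sup>2)"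
    unfolding sqnorm_def by (rule sum.swap)
  also have "\<dots> = (\<Sum>\<sigma>\<in>layer m. \<Sum>v\<in>V - \<sigma>. if \<sigma> \<in> X then (norm (\<omega> (insert v \<sigma>)))\<^sup>2 else 0)"
  proof (rule sum.mono_neutral_cong_left[OF finite_layer faces_subset_layer[OF X]])
    fix \<sigma> assume "\<sigma> \<in> {\<sigma> \<in> X. card \<sigma> = m}"
    then show "(\<Sum>v\<in>V. (norm (contract v \<omega> \<sigma>))\<^sup>2) =
        (\<Sum>v\<in>V - \<sigma>. if \<sigma> \<in> X then (norm (\<omega> (insert v \<sigma>)))\<^sup>2 else 0)"
      using finite_V faces_subset_layer[OF X, of m]
      by (intro sum.mono_neutral_cong_right) (auto simp: contract_def norm_mult norm_sign layer_def)
  qed (rule ballI, rule sum.neutral, auto simp: layer_def)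
  also have "\<dots> = (\<Sum>\<rho>\<in>layer (Suc m). \<Sum>v\<in>\<rho>. if \<rho> - {v} \<in> X then (norm (\<omega> \<rho>))\<^sup>2 else 0)"
    by (rule sum_layer_swap)
  finally show ?thesis .
qed

lemma sqnorm_cobd_contract:
  assumes X: "simplicial_complex V X" and \<phi>: "\<phi> \<in> l2 {\<sigma> \<in> X. card \<sigma> = Suc j}"
  shows "(\<Sum>v\<in>V. sqnorm {\<sigma> \<in> X. card \<sigma> = Suc j} (cobd (contract v \<phi>))) =
    card V * sqnorm {\<sigma> \<in> X. card \<sigma> = Suc j} \<phi> - 2 * sqnorm (layer (Suc (Suc j))) (cobd \<phi>)
    + (\<Sum>v\<in>V. sqnorm {\<sigma> \<in> X. card \<sigma> = Suc j} (contract v (cobd \<phi>)))"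
proof -
  define F where "F = {\<sigma> \<in> X. card \<sigma> = Suc j}"
  define \<omega> where "\<omega> = cobd \<phi>"
  define N where "N = sqnorm (layer (Suc (Suc j))) \<omega>"
  have F: "F \<subseteq> layer (Suc j)" unfolding F_def by (rule faces_subset_layer[OF X])
  have cjm1: "cj (- 1) = - 1" using cj_of_real[of "-1"] by simp
  have expand: "of_real (sqnorm F (cobd (contract v \<phi>))) =
      of_real (sqnorm F \<phi>) - inner F \<phi> (contract v \<omega>) - inner F (contract v \<omega>) \<phi>
      + of_real (sqnorm F (contract v \<omega>))" if "v \<in> V" for v
  proof -
    have "sqnorm F (cobd (contract v \<phi>)) = sqnorm F (\<lambda>\<sigma>. \<phi> \<sigma> + (- 1) * contract v \<omega> \<sigma>)"
      unfolding sqnorm_def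
    proof (rule sum.cong[OF refl])
      fix \<sigma> assume "\<sigma> \<in> F"
      then have "\<sigma> \<subseteq> V" using F by (auto simp: layer_def)
      from cobd_contract[OF this that, of \<phi>]
      have "cobd (contract v \<phi>) \<sigma> = \<phi> \<sigma> + (- 1) * contract v \<omega> \<sigma>"
        by (simp add: \<omega>_def eq_diff_eq)
      then show "(norm (cobd (contract v \<phi>) \<sigma>))\<^sup>2 = (norm (\<phi> \<sigma> + (- 1) * contract v \<omega> \<sigma>))\<^sup>2"
        by simp
    qed
    moreover have "of_real (sqnorm F (\<lambda>\<sigma>. \<phi> \<sigma> + (- 1) * contract v \<omega> \<sigma>)) =
        inner F \<phi> \<phi> - inner F \<phi> (contract v \<omega>) - inner F (contract v \<omega>) \<phi>
        + inner F (contract v \<omega>) (contract v \<omega>)"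
      unfolding inner_self[symmetric] inner_add_left inner_add_right inner_scale_left
        inner_scale_right cjm1 by simp
    ultimately show ?thesis by (simp only: inner_self)
  qed
  \<comment> \<open>The contractions sum to the adjoint \<open>bd\<close>. The support of \<phi>
    allows passing from \<open>F\<close> to the full layer, where adjointness holds.\<close>
  have cross: "(\<Sum>v\<in>V. inner F \<phi> (contract v \<omega>)) = of_real N"
  proof -
    have "(\<Sum>v\<in>V. inner F \<phi> (contract v \<omega>)) = inner F \<phi> (bd \<omega>)"
      unfolding l2_inner_def bd_def cj_sum sum_distrib_left by (rule sum.swap)
    also have "\<dots> = inner (layer (Suc j)) \<phi> (bd \<omega>)"
      unfolding l2_inner_def using F \<phi> finite_layer
      by (intro sum.mono_neutral_left) (auto simp: l2_def F_def)
    finally show ?thesis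
      by (simp add: N_def inner_self \<omega>_def flip: inner_cobd)
  qed
  have "(\<Sum>v\<in>V. inner F (contract v \<omega>) \<phi>) = cj (\<Sum>v\<in>V. inner F \<phi> (contract v \<omega>))"
    by (simp add: cj_sum cj_inner)
  then have cross': "(\<Sum>v\<in>V. inner F (contract v \<omega>) \<phi>) = of_real N"
    by (simp add: cross cj_of_real)
  have "of_real (\<Sum>v\<in>V. sqnorm F (cobd (contract v \<phi>))) =
      (of_real (card V * sqnorm F \<phi> - 2 * N + (\<Sum>v\<in>V. sqnorm F (contract v \<omega>))) :: 'a)"
    using expand by (simp add: sum.distrib sum_subtractf cross cross')
  then show ?thesis
    unfolding of_real_eq_iff by (simp add: F_def \<omega>_def N_def)
qed

lemma sqnorm_cobd_le_contract:
  assumes X: "simplicial_complex V X" and \<phi>: "\<phi> \<in> l2 {\<sigma> \<in> X. card \<sigma> = Suc j}"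
  shows "Suc j * sqnorm {\<sigma> \<in> X. card \<sigma> = Suc (Suc j)} (cobd \<phi>) \<le>
    (\<Sum>v\<in>V. sqnorm {\<sigma> \<in> X. card \<sigma> = Suc j} (cobd (contract v \<phi>)))"
proof -
  define w where "w \<rho> = (norm (cobd \<phi> \<rho>))\<^sup>2" for \<rho>
  \<comment> \<open>On \<open>X\<close> all \<open>j + 2\<close> facets count and one is subtracted.
    Off \<open>X\<close> either some facet in \<open>X\<close> pays for the subtraction, or \<phi>
    vanishes on all facets and so \<open>w \<rho> = 0\<close>.\<close>
  have pointwise: "(if \<rho> \<in> X then Suc j * w \<rho> else 0) \<le>
      (\<Sum>v\<in>\<rho>. if \<rho> - {v} \<in> X then w \<rho> else 0) - w \<rho>" if \<rho>: "\<rho> \<in> layer (Suc (Suc j))" for \<rho>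
  proof (cases "\<rho> \<in> X")
    case True
    then have "\<forall>v\<in>\<rho>. \<rho> - {v} \<in> X"
      using X by (auto simp: simplicial_complex_def)
    then have "(\<Sum>v\<in>\<rho>. if \<rho> - {v} \<in> X then w \<rho> else 0) = Suc (Suc j) * w \<rho>"
      using \<rho> by (simp add: layer_def)
    then show ?thesis using True by (simp add: algebra_simps)
  next
    case False
    have fin: "finite \<rho>" using \<rho> finite_V finite_subset by (auto simp: layer_def)
    have "w \<rho> \<le> (\<Sum>v\<in>\<rho>. if \<rho> - {v} \<in> X then w \<rho> else 0)"
    proof (cases "\<exists>v\<in>\<rho>. \<rho> - {v} \<in> X")
      case True
      then obtain v where v: "v \<in> \<rho>" "\<rho> - {v} \<in> X" by blast
      then have "w \<rho> = (if \<rho> - {v} \<in> X then w \<rho> else 0)" by simp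
      also have "\<dots> \<le> (\<Sum>v\<in>\<rho>. if \<rho> - {v} \<in> X then w \<rho> else 0)"
        by (rule member_le_sum) (use v fin in \<open>auto simp: w_def\<close>)
      finally show ?thesis .
    next
      case False
      then have "cobd \<phi> \<rho> = 0"
        unfolding cobd_def using \<phi> by (intro sum.neutral) (auto simp: l2_def)
      then show ?thesis by (auto simp: w_def intro!: sum_nonneg)
    qed
    then show ?thesis using False by simp
  qed
  have "Suc j * sqnorm {\<sigma> \<in> X. card \<sigma> = Suc (Suc j)} (cobd \<phi>) =
      (\<Sum>\<rho>\<in>layer (Suc (Suc j)). if \<rho> \<in> X then Suc j * w \<rho> else 0)"
    unfolding sqnorm_def sum_distrib_left
    using faces_subset_layer[OF X, of "Suc (Suc j)"] finite_layer
    by (intro sum.mono_neutral_cong_left) (auto simp: layer_def w_def)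
  also have "\<dots> \<le> (\<Sum>\<rho>\<in>layer (Suc (Suc j)). (\<Sum>v\<in>\<rho>. if \<rho> - {v} \<in> X then w \<rho> else 0) - w \<rho>)"
    by (intro sum_mono pointwise)
  also have "\<dots> = (\<Sum>v\<in>V. sqnorm {\<sigma> \<in> X. card \<sigma> = Suc j} (contract v (cobd \<phi>)))
      - sqnorm (layer (Suc (Suc j))) (cobd \<phi>)"
    unfolding sum_sqnorm_contract_cobd[OF X] sum_subtractf w_def by (simp only: sqnorm_def)
  \<comment> \<open>\<open>sqnorm_cobd_le\<close> absorbs one of the two copies of the squared norm
    of \<open>cobd \<phi>\<close> into the term with \<open>card V\<close>.\<close>
  also have "\<dots> \<le> (\<Sum>v\<in>V. sqnorm {\<sigma> \<in> X. card \<sigma> = Suc j} (cobd (contract v \<phi>)))"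
    using sqnorm_cobd_le[of j \<phi>]
    unfolding sqnorm_cobd_contract[OF X \<phi>] sqnorm_subset_support[OF \<phi> faces_subset_layer[OF X] finite_layer]
    by linarith
  finally show ?thesis .
qed

lemma contract_in_l2:
  assumes X: "simplicial_complex V X" and \<phi>: "\<phi> \<in> l2 {\<sigma> \<in> X. card \<sigma> = Suc j}"
  shows "contract v \<phi> \<in> l2 {\<sigma> \<in> X. card \<sigma> = j}"
proof -
  have "\<tau> \<in> X \<and> card \<tau> = j" if "v \<notin> \<tau>" "\<phi> (insert v \<tau>) \<noteq> 0" for \<tau>
  proof -
    have *: "insert v \<tau> \<in> X" "card (insert v \<tau>) = Suc j"
      using \<phi> that(2) by (auto simp: l2_def)
    moreover have "finite \<tau>" using *(2) card_ge_0_finite[of "insert v \<tau>"] by simp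
    ultimately show ?thesis
      using X that(1) by (auto simp: simplicial_complex_def)
  qed
  then show ?thesis by (auto simp: l2_def contract_def)
qed

text \<open>The contractions of \<phi> are the test functions for \<open>bound\<close>; the factor
  \<open>Suc j\<close> from both counts cancels.\<close>

theorem cobd_bound_Suc:
  assumes X: "simplicial_complex V X"
    and bound: "\<And>\<psi>. \<psi> \<in> l2 {\<sigma> \<in> X. card \<sigma> = j} \<Longrightarrow>
      sqnorm {\<sigma> \<in> X. card \<sigma> = Suc j} (cobd \<psi>) \<le> c * sqnorm {\<sigma> \<in> X. card \<sigma> = j} \<psi>"
    and c: "0 \<le> c" and \<phi>: "\<phi> \<in> l2 {\<sigma> \<in> X. card \<sigma> = Suc j}"
  shows "sqnorm {\<sigma> \<in> X. card \<sigma> = Suc (Suc j)} (cobd \<phi>) \<le> c * sqnorm {\<sigma> \<in> X. card \<sigma> = Suc j} \<phi>"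
proof -
  have "Suc j * sqnorm {\<sigma> \<in> X. card \<sigma> = Suc (Suc j)} (cobd \<phi>) \<le>
      (\<Sum>v\<in>V. sqnorm {\<sigma> \<in> X. card \<sigma> = Suc j} (cobd (contract v \<phi>)))"
    by (rule sqnorm_cobd_le_contract[OF X \<phi>])
  also have "\<dots> \<le> (\<Sum>v\<in>V. c * sqnorm {\<sigma> \<in> X. card \<sigma> = j} (contract v \<phi>))"
    by (intro sum_mono bound contract_in_l2[OF X \<phi>])
  also have "\<dots> \<le> c * (Suc j * sqnorm {\<sigma> \<in> X. card \<sigma> = Suc j} \<phi>)"
    unfolding sum_distrib_left[symmetric]
    by (intro mult_left_mono sum_sqnorm_contract_le[OF X \<phi>] c)
  finally have "real (Suc j) * sqnorm {\<sigma> \<in> X. card \<sigma> = Suc (Suc j)} (cobd \<phi>) \<le>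
      real (Suc j) * (c * sqnorm {\<sigma> \<in> X. card \<sigma> = Suc j} \<phi>)"
    by (simp add: ac_simps)
  then show ?thesis
    by (rule mult_left_le_imp_le) simp
qed

end

subsection \<open>Laplacians of a simplicial complex\<close>

locale simplicial_laplacian = scalar_conjugation cj
  for cj :: "'a::real_normed_field \<Rightarrow> 'a" +
  fixes V :: "'v set" and X :: "'v set set" and d :: "int \<Rightarrow> ('v set \<Rightarrow> 'a) \<Rightarrow> ('v set \<Rightarrow> 'a)"
  assumes fin_V: "finite V" and X: "simplicial_complex V X" and d: "coboundary_operators (Pow V) d"
begin

text \<open>The dimension is read off from \<tau>, so one function covers all the operators
  \<open>d k\<close>.\<close>

definition coeff :: "'v set \<Rightarrow> 'v set \<Rightarrow> 'a" where
  "coeff \<tau> \<sigma> = d (int (card \<tau>) - 1) (delta \<tau>) \<sigma>"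

lemma fin_Pow: "finite (simplices (Pow V) k)"
  using fin_V by (simp add: simplices_def)

lemma d_linear: "-1 \<le> k \<Longrightarrow> l2_linear (simplices (Pow V) k) (simplices (Pow V) (k + 1)) (d k)"
  using d by (simp add: coboundary_operators_def)

lemma d_d: "-1 \<le> k \<Longrightarrow> \<phi> \<in> l2 (simplices (Pow V) k) \<Longrightarrow> d (k + 1) (d k \<phi>) = (\<lambda>_. 0)"
  using d by (simp add: coboundary_operators_def)

lemma d_delta:
  assumes "-1 \<le> k" "\<tau> \<in> simplices (Pow V) k" "\<sigma> \<in> simplices (Pow V) (k + 1)"
  shows "d k (delta \<tau>) \<sigma> \<in> {1, -1, 0}" "d k (delta \<tau>) \<sigma> \<noteq> 0 \<longleftrightarrow> covers \<tau> \<sigma>"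
  using d assms unfolding coboundary_operators_def delta_def by blast+

text \<open>Expand \<phi> in delta functions; only facets of \<sigma> have a nonzero entry
  there.\<close>

lemma d_apply:
  assumes k: "-1 \<le> k" and \<phi>: "\<phi> \<in> l2 (simplices (Pow V) k)" and \<sigma>: "\<sigma> \<in> simplices (Pow V) (k + 1)"
  shows "d k \<phi> \<sigma> = (\<Sum>v\<in>\<sigma>. coeff (\<sigma> - {v}) \<sigma> * \<phi> (\<sigma> - {v}))"
proof -
  have fin: "finite \<sigma>" using \<sigma> fin_V finite_subset by (auto simp: simplices_def)
  have facet: "\<sigma> - {v} \<in> simplices (Pow V) k" if "v \<in> \<sigma>" for v
    using \<sigma> that fin card_gt_0_iff[of \<sigma>] by (auto simp: simplices_def of_nat_diff)
  have "d k \<phi> \<sigma> = (\<Sum>\<tau>\<in>simplices (Pow V) k. \<phi> \<tau> * d k (delta \<tau>) \<sigma>)"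
    by (subst l2_linear_expansion[OF d_linear[OF k] fin_Pow \<phi>]) simp
  also have "\<dots> = (\<Sum>\<tau>\<in>(\<lambda>v. \<sigma> - {v}) ` \<sigma>. \<phi> \<tau> * d k (delta \<tau>) \<sigma>)"
  proof (rule sum.mono_neutral_right[OF fin_Pow])
    show "(\<lambda>v. \<sigma> - {v}) ` \<sigma> \<subseteq> simplices (Pow V) k" using facet by auto
    show "\<forall>\<tau>\<in>simplices (Pow V) k - (\<lambda>v. \<sigma> - {v}) ` \<sigma>. \<phi> \<tau> * d k (delta \<tau>) \<sigma> = 0"
    proof
      fix \<tau> assume \<tau>: "\<tau> \<in> simplices (Pow V) k - (\<lambda>v. \<sigma> - {v}) ` \<sigma>"
      have "\<not> covers \<tau> \<sigma>"
      proof
        assume "covers \<tau> \<sigma>"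
        then obtain v where "\<tau> \<subseteq> \<sigma>" "\<sigma> - \<tau> = {v}"
          by (auto simp: covers_def card_1_singleton_iff)
        then have "v \<in> \<sigma>" "\<tau> = \<sigma> - {v}" by auto
        then show False using \<tau> by auto
      qed
      then show "\<phi> \<tau> * d k (delta \<tau>) \<sigma> = 0"
        using d_delta(2)[OF k _ \<sigma>, of \<tau>] \<tau> by simp
    qed
  qed
  also have "\<dots> = (\<Sum>v\<in>\<sigma>. \<phi> (\<sigma> - {v}) * d k (delta (\<sigma> - {v})) \<sigma>)"
    by (subst sum.reindex) (auto simp: inj_on_def)
  also have "\<dots> = (\<Sum>v\<in>\<sigma>. coeff (\<sigma> - {v}) \<sigma> * \<phi> (\<sigma> - {v}))"
    using facet by (intro sum.cong refl) (auto simp: coeff_def simplices_def mult.commute)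
  finally show ?thesis .
qed

lemma coeff_eq:
  assumes "\<tau> \<subseteq> V" "\<sigma> \<subseteq> V" "card \<sigma> = Suc (card \<tau>)"
  shows "coeff \<tau> \<sigma> \<in> {1, -1, 0}" "coeff \<tau> \<sigma> \<noteq> 0 \<longleftrightarrow> covers \<tau> \<sigma>"
  using assms d_delta[of "int (card \<tau>) - 1" \<tau> \<sigma>] by (auto simp: coeff_def simplices_def)

sublocale incidence cj V coeff
proof
  show "finite V" by (rule fin_V)
  fix \<tau> assume \<tau>: "\<tau> \<subseteq> V"
  have fin: "finite \<tau>" using \<tau> fin_V finite_subset by blast
  show "coeff \<tau> (insert v \<tau>) \<in> {1, -1}" if v: "v \<in> V - \<tau>" for v
  proof -
    have "insert v \<tau> - \<tau> = {v}" using v by auto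
    then have "covers \<tau> (insert v \<tau>)" by (auto simp: covers_def)
    then show ?thesis using coeff_eq[of \<tau> "insert v \<tau>"] \<tau> v fin by auto
  qed
  fix u v assume u: "u \<in> V - \<tau>" and v: "v \<in> V - \<tau>" and uv: "u \<noteq> v"
  define k where "k = int (card \<tau>) - 1"
  define \<rho> where "\<rho> = insert v (insert u \<tau>)"
  define g where "g = d k (delta \<tau>)"
  have k: "-1 \<le> k" "-1 \<le> k + 1" by (auto simp: k_def)
  have \<tau>_in: "\<tau> \<in> simplices (Pow V) k" using \<tau> by (auto simp: simplices_def k_def)
  have \<rho>: "\<rho> \<in> simplices (Pow V) (k + 1 + 1)"
    using \<tau> u v uv fin by (auto simp: simplices_def k_def \<rho>_def)
  have g: "g \<in> l2 (simplices (Pow V) (k + 1))"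
    unfolding g_def using l2_linear_in_l2[OF d_linear[OF k(1)] delta_in_l2[OF \<tau>_in]] .
  \<comment> \<open>Evaluate \<open>d d = 0\<close> on the delta function of \<tau> at \<rho>.
    Removing a vertex of \<tau> from \<rho> gives a simplex that does not contain \<tau>, so only
    the terms for \<open>u\<close> and \<open>v\<close> remain.\<close>
  have "0 = d (k + 1) g \<rho>"
    unfolding g_def d_d[OF k(1) delta_in_l2[OF \<tau>_in]] by simp
  also have "\<dots> = (\<Sum>w\<in>\<rho>. coeff (\<rho> - {w}) \<rho> * g (\<rho> - {w}))"
    by (rule d_apply[OF k(2) g \<rho>])
  also have "\<dots> = (\<Sum>w\<in>{u, v}. coeff (\<rho> - {w}) \<rho> * g (\<rho> - {w}))"
  proof (rule sum.mono_neutral_right)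
    show "\<forall>w\<in>\<rho> - {u, v}. coeff (\<rho> - {w}) \<rho> * g (\<rho> - {w}) = 0"
    proof
      fix w assume w: "w \<in> \<rho> - {u, v}"
      then have "\<not> covers \<tau> (\<rho> - {w})" by (auto simp: covers_def \<rho>_def)
      moreover have "\<rho> - {w} \<in> simplices (Pow V) (k + 1)"
        using \<rho> w fin u v uv by (auto simp: simplices_def \<rho>_def k_def)
      ultimately have "g (\<rho> - {w}) = 0"
        using d_delta(2)[OF k(1) \<tau>_in] unfolding g_def by blast
      then show "coeff (\<rho> - {w}) \<rho> * g (\<rho> - {w}) = 0" by simp
    qed
  qed (use fin in \<open>auto simp: \<rho>_def\<close>)
  also have "\<dots> = coeff (\<rho> - {u}) \<rho> * g (\<rho> - {u}) + coeff (\<rho> - {v}) \<rho> * g (\<rho> - {v})"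
    using uv by simp
  also have "\<rho> - {u} = insert v \<tau>" using u uv by (auto simp: \<rho>_def)
  also have "\<rho> - {v} = insert u \<tau>" using v uv by (auto simp: \<rho>_def)
  finally show "coeff \<tau> (insert u \<tau>) * coeff (insert u \<tau>) (insert v (insert u \<tau>))
      + coeff \<tau> (insert v \<tau>) * coeff (insert v \<tau>) (insert v (insert u \<tau>)) = 0"
    by (simp add: g_def coeff_def k_def \<rho>_def ac_simps)
qed

section \<open>Coboundary and boundary of the complex \<open>X\<close>\<close>

abbreviation D where "D \<equiv> coboundary X d"
abbreviation B where "B \<equiv> boundary cj X d"

lemma fin_simplices: "finite (simplices X k)"
proof (rule finite_subset)
  show "simplices X k \<subseteq> Pow V" using X by (auto simp: simplices_def simplicial_complex_def)
  show "finite (Pow V)" using fin_V by simp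
qed

lemma simplices_subset: "simplices X k \<subseteq> simplices (Pow V) k"
  using X by (auto simp: simplices_def simplicial_complex_def)

lemma l2_extend: "\<phi> \<in> l2 (simplices X k) \<Longrightarrow> \<phi> \<in> l2 (simplices (Pow V) k)"
  using simplices_subset[of k] by (auto simp: l2_def)

lemma D_apply:
  assumes "-1 \<le> k" and "\<phi> \<in> l2 (simplices X k)"
  shows "D k \<phi> = (\<lambda>\<sigma>. if \<sigma> \<in> simplices X (k + 1) then cobd \<phi> \<sigma> else 0)"
  using d_apply[OF assms(1) l2_extend[OF assms(2)]] simplices_subset[of "k + 1"]
  by (auto simp: coboundary_def l2_restrict_def cobd_def fun_eq_iff)

lemma D_linear:
  assumes k: "-1 \<le> k"
  shows "l2_linear (simplices X k) (simplices X (k + 1)) (D k)"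
  unfolding l2_linear_def
proof (intro conjI ballI allI)
  note lin = d_linear[OF k]
  show "D k \<phi> \<in> l2 (simplices X (k + 1))" for \<phi>
    by (simp add: coboundary_def l2_restrict_def l2_def)
  show "D k (\<lambda>x. \<phi> x + \<psi> x) = (\<lambda>y. D k \<phi> y + D k \<psi> y)"
    if "\<phi> \<in> l2 (simplices X k)" "\<psi> \<in> l2 (simplices X k)" for \<phi> \<psi>
    using l2_linear_add[OF lin that[THEN l2_extend]]
    by (simp add: coboundary_def l2_restrict_def fun_eq_iff)
  show "D k (\<lambda>x. c * \<phi> x) = (\<lambda>y. c * D k \<phi> y)" if "\<phi> \<in> l2 (simplices X k)" for c \<phi>
    using l2_linear_scale[OF lin that[THEN l2_extend]]
    by (simp add: coboundary_def l2_restrict_def fun_eq_iff)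
qed

text \<open>All facets of a face of \<open>X\<close> lie in \<open>X\<close>, so restricting between
  the two coboundaries changes nothing on faces of \<open>X\<close>.\<close>

lemma D_D:
  assumes k: "-1 \<le> k" and \<phi>: "\<phi> \<in> l2 (simplices X k)"
  shows "D (k + 1) (D k \<phi>) = (\<lambda>_. 0)"
proof -
  have D\<phi>: "D k \<phi> \<in> l2 (simplices X (k + 1))"
    by (rule l2_linear_in_l2[OF D_linear[OF k] \<phi>])
  have d\<phi>: "d k \<phi> \<in> l2 (simplices (Pow V) (k + 1))"
    by (rule l2_linear_in_l2[OF d_linear[OF k] l2_extend[OF \<phi>]])
  have "cobd (D k \<phi>) \<sigma> = 0" if \<sigma>: "\<sigma> \<in> simplices X (k + 1 + 1)" for \<sigma>
  proof -
    have "finite \<sigma>" using \<sigma> X fin_V finite_subset by (auto simp: simplices_def simplicial_complex_def)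
    then have facet: "\<sigma> - {v} \<in> simplices X (k + 1)" if "v \<in> \<sigma>" for v
      using \<sigma> that X k card_gt_0_iff[of \<sigma>]
      by (auto simp: simplices_def simplicial_complex_def of_nat_diff)
    have "cobd (D k \<phi>) \<sigma> = (\<Sum>v\<in>\<sigma>. coeff (\<sigma> - {v}) \<sigma> * d k \<phi> (\<sigma> - {v}))"
      unfolding cobd_def using facet by (simp add: coboundary_def l2_restrict_def)
    also have "\<dots> = d (k + 1) (d k \<phi>) \<sigma>"
      using k \<sigma> simplices_subset by (intro d_apply[symmetric] d\<phi>) auto
    finally show ?thesis using d_d[OF k l2_extend[OF \<phi>]] by simp
  qed
  then show ?thesis
    using D_apply[OF _ D\<phi>] k by (auto simp: fun_eq_iff)
qed

lemma B_linear: "-1 \<le> k \<Longrightarrow> l2_linear (simplices X (k + 1)) (simplices X k) (B k)"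
  unfolding boundary_def by (intro l2_linear_adj fin_simplices D_linear)

lemma inner_D:
  "-1 \<le> k \<Longrightarrow> \<phi> \<in> l2 (simplices X k) \<Longrightarrow>
    inner (simplices X (k + 1)) (D k \<phi>) \<psi> = inner (simplices X k) \<phi> (B k \<psi>)"
  unfolding boundary_def by (intro l2_adjoint(2) fin_simplices D_linear cj_cj)

lemma inner_B:
  "-1 \<le> k \<Longrightarrow> \<phi> \<in> l2 (simplices X k) \<Longrightarrow>
    inner (simplices X k) (B k \<psi>) \<phi> = inner (simplices X (k + 1)) \<psi> (D k \<phi>)"
  using inner_D[of k \<phi> \<psi>] cj_inner by metis

text \<open>Stands for \<open>c\<^sub>k \<le> c\<close>. The least constant is never named: each
  maximal eigenvalue is compared with arbitrary \<open>c\<close> through this predicate.\<close>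

definition cobd_bound :: "int \<Rightarrow> real \<Rightarrow> bool" where
  "cobd_bound k c \<longleftrightarrow>
    (\<forall>\<phi>\<in>l2 (simplices X k). sqnorm (simplices X (k + 1)) (D k \<phi>) \<le> c * sqnorm (simplices X k) \<phi>)"

lemma cobd_bound_step:
  assumes k: "0 \<le> k" and c: "0 \<le> c" and bound: "cobd_bound (k - 1) c"
  shows "cobd_bound k c"
proof -
  \<comment> \<open>Passes from dimension to cardinality: dimension \<open>k - 1\<close> is
    cardinality \<open>j\<close>. For \<open>k = 0\<close> the lower level is that of the empty
    simplex.\<close>
  define j where "j = nat k"
  have F: "simplices X (k - 1) = {\<sigma> \<in> X. card \<sigma> = j}" "simplices X k = {\<sigma> \<in> X. card \<sigma> = Suc j}"
    "simplices X (k + 1) = {\<sigma> \<in> X. card \<sigma> = Suc (Suc j)}"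
    using k by (auto simp: simplices_def j_def)
  have D_sqnorm: "sqnorm (simplices X (i + 1)) (D i \<phi>) = sqnorm (simplices X (i + 1)) (cobd \<phi>)"
    if "-1 \<le> i" "\<phi> \<in> l2 (simplices X i)" for i \<phi>
    unfolding sqnorm_def D_apply[OF that] by (intro sum.cong) auto
  have "sqnorm (simplices X k) (cobd \<psi>) \<le> c * sqnorm (simplices X (k - 1)) \<psi>"
    if "\<psi> \<in> l2 (simplices X (k - 1))" for \<psi>
    using bound that D_sqnorm[of "k - 1" \<psi>] k by (auto simp: cobd_bound_def)
  then show ?thesis
    unfolding cobd_bound_def
    using cobd_bound_Suc[OF X _ c, of j] D_sqnorm[of k] k unfolding F by fastforce
qed

text \<open>The quadratic forms of the Laplacians as real numbers, to serve as \<open>q\<close> in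
  \<open>symmetric_operator\<close>.\<close>

primrec form :: "laplacian_kind \<Rightarrow> int \<Rightarrow> ('v set \<Rightarrow> 'a) \<Rightarrow> real" where
  "form Up k \<phi> = sqnorm (simplices X (k + 1)) (D k \<phi>)"
| "form Down k \<phi> = sqnorm (simplices X (k - 1)) (B (k - 1) \<phi>)"
| "form Hodge k \<phi> =
    sqnorm (simplices X (k + 1)) (D k \<phi>) + sqnorm (simplices X (k - 1)) (B (k - 1) \<phi>)"

lemma form_nonneg: "0 \<le> form t k \<phi>"
  by (cases t) (simp_all add: sqnorm_nonneg)

section \<open>Maximal eigenvalues in a fixed dimension\<close>

context
  fixes k :: int
  assumes k: "0 \<le> k" and nonempty: "simplices X k \<noteq> {}"
begin

lemma k_bounds: "-1 \<le> k" "-1 \<le> k - 1"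
  using k by auto

lemmas Dk = D_linear[OF k_bounds(1)]
  and Bk = B_linear[OF k_bounds(1)]
  and Dk1 = D_linear[OF k_bounds(2), simplified]
  and Bk1 = B_linear[OF k_bounds(2), simplified]
  and inner_D1 = inner_D[OF k_bounds(2), simplified]
  and inner_B1 = inner_B[OF k_bounds(2), simplified]

lemma laplacian_linear: "l2_linear (simplices X k) (simplices X k) (laplacian cj X d t k)"
proof -
  have up: "l2_linear (simplices X k) (simplices X k) (up_laplacian cj X d k)"
    using Dk Bk unfolding l2_linear_def up_laplacian_def by auto
  have down: "l2_linear (simplices X k) (simplices X k) (down_laplacian cj X d k)"
    using Dk1 Bk1 unfolding l2_linear_def down_laplacian_def by auto
  have "l2_linear (simplices X k) (simplices X k)
      (\<lambda>\<phi> \<sigma>. up_laplacian cj X d k \<phi> \<sigma> + down_laplacian cj X d k \<phi> \<sigma>)"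
    using up down unfolding l2_linear_def by (auto simp: l2_def algebra_simps)
  moreover have "laplacian cj X d Up k = up_laplacian cj X d k"
    "laplacian cj X d Down k = down_laplacian cj X d k"
    "laplacian cj X d Hodge k = (\<lambda>\<phi> \<sigma>. up_laplacian cj X d k \<phi> \<sigma> + down_laplacian cj X d k \<phi> \<sigma>)"
    by (simp_all add: fun_eq_iff)
  ultimately show ?thesis using up down by (cases t) simp_all
qed

lemma inner_up:
  assumes "\<phi> \<in> l2 (simplices X k)" "\<psi> \<in> l2 (simplices X k)"
  shows "inner (simplices X k) (up_laplacian cj X d k \<phi>) \<psi> =
      inner (simplices X (k + 1)) (D k \<phi>) (D k \<psi>)"
    and "inner (simplices X k) \<phi> (up_laplacian cj X d k \<psi>) =
      inner (simplices X (k + 1)) (D k \<phi>) (D k \<psi>)"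
  by (simp_all add: up_laplacian_def inner_B[OF k_bounds(1)] assms flip: inner_D[OF k_bounds(1)])

lemma inner_down:
  assumes "\<phi> \<in> l2 (simplices X k)" "\<psi> \<in> l2 (simplices X k)"
  shows "inner (simplices X k) (down_laplacian cj X d k \<phi>) \<psi> =
      inner (simplices X (k - 1)) (B (k - 1) \<phi>) (B (k - 1) \<psi>)"
    and "inner (simplices X k) \<phi> (down_laplacian cj X d k \<psi>) =
      inner (simplices X (k - 1)) (B (k - 1) \<phi>) (B (k - 1) \<psi>)"
  by (simp_all add: down_laplacian_def inner_D1 inner_B1[symmetric] assms l2_linear_in_l2[OF Bk1])

lemma symmetric_laplacian:
  "symmetric_operator cj (simplices X k) (laplacian cj X d t k) (form t k)"
proof
  show "finite (simplices X k)" by (rule fin_simplices)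
  show "simplices X k \<noteq> {}" by (rule nonempty)
  show "l2_linear (simplices X k) (simplices X k) (laplacian cj X d t k)" by (rule laplacian_linear)
  show "inner (simplices X k) (laplacian cj X d t k \<phi>) \<psi> = inner (simplices X k) \<phi> (laplacian cj X d t k \<psi>)"
    if "\<phi> \<in> l2 (simplices X k)" "\<psi> \<in> l2 (simplices X k)" for \<phi> \<psi>
    by (cases t) (simp_all add: inner_up inner_down inner_add_left inner_add_right that)
  show "inner (simplices X k) (laplacian cj X d t k \<phi>) \<phi> = of_real (form t k \<phi>)"
    if "\<phi> \<in> l2 (simplices X k)" for \<phi>
    by (cases t) (simp_all add: inner_up inner_down inner_add_left that inner_self)
qed

lemmas max_eigenvector = symmetric_operator.max_eigenvector[OF symmetric_laplacian, folded max_eigenvalue_def]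
  and form_le_max_eigenvalue = symmetric_operator.form_le_max[OF symmetric_laplacian, folded max_eigenvalue_def]

lemma max_eigenvalue_leI:
  assumes "\<And>\<phi>. \<phi> \<in> l2 (simplices X k) \<Longrightarrow> form t k \<phi> \<le> c * sqnorm (simplices X k) \<phi>"
  shows "max_eigenvalue cj X d t k \<le> c"
proof (rule symmetric_operator.eigenvalue_le[OF symmetric_laplacian])
  show "\<forall>\<phi>\<in>l2 (simplices X k). form t k \<phi> \<le> c * sqnorm (simplices X k) \<phi>" using assms by blast
  show "of_real (max_eigenvalue cj X d t k) \<in> l2_spectrum (simplices X k) (laplacian cj X d t k)"
    using max_eigenvector l2_spectrum_iff_eigenvector[OF fin_simplices laplacian_linear] by blast
qed

lemma max_eigenvalue_nonneg: "0 \<le> max_eigenvalue cj X d t k"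
proof -
  obtain \<phi> :: "'v set \<Rightarrow> 'a" where \<phi>: "\<phi> \<in> l2 (simplices X k)" "\<phi> \<noteq> (\<lambda>_. 0)"
    using max_eigenvector[of t] by blast
  have "0 \<le> max_eigenvalue cj X d t k * sqnorm (simplices X k) \<phi>"
    using form_nonneg[of t k \<phi>] form_le_max_eigenvalue[OF \<phi>(1), of t] by linarith
  moreover have "sqnorm (simplices X k) \<phi> > 0"
    using sqnorm_eq_0_iff[OF fin_simplices \<phi>(1)] sqnorm_nonneg[of "simplices X k" \<phi>] \<phi>(2) by linarith
  ultimately show ?thesis by (simp add: zero_le_mult_iff)
qed

lemma max_up_le_iff: "max_eigenvalue cj X d Up k \<le> c \<longleftrightarrow> cobd_bound k c"
proof
  assume le: "max_eigenvalue cj X d Up k \<le> c"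
  show "cobd_bound k c"
    unfolding cobd_bound_def
    using form_le_max_eigenvalue[of _ Up] mult_right_mono[OF le sqnorm_nonneg] by (auto intro: order_trans)
next
  assume "cobd_bound k c"
  then show "max_eigenvalue cj X d Up k \<le> c"
    by (intro max_eigenvalue_leI) (simp add: cobd_bound_def)
qed

text \<open>The form is the squared norm of the boundary, and \<open>adjoint_bound\<close> passes
  between boundary and coboundary in both directions.\<close>

lemma max_down_le_iff:
  assumes c: "0 \<le> c"
  shows "max_eigenvalue cj X d Down k \<le> c \<longleftrightarrow> cobd_bound (k - 1) c"
proof
  assume le: "max_eigenvalue cj X d Down k \<le> c"
  have bound: "sqnorm (simplices X (k - 1)) (B (k - 1) \<phi>) \<le> c * sqnorm (simplices X k) \<phi>"
    if "\<phi> \<in> l2 (simplices X k)" for \<phi>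
    using form_le_max_eigenvalue[OF that, of Down] mult_right_mono[OF le sqnorm_nonneg, of "simplices X k" \<phi>]
    by simp
  have "sqnorm (simplices X k) (D (k - 1) \<phi>) \<le> c * sqnorm (simplices X (k - 1)) \<phi>"
    if "\<phi> \<in> l2 (simplices X (k - 1))" for \<phi>
    by (rule adjoint_bound[where D = "B (k - 1)" and S = "simplices X k" and T = "simplices X (k - 1)"])
      (simp_all add: fin_simplices l2_linear_in_l2[OF Bk1] l2_linear_in_l2[OF Dk1] inner_B1 bound c that)
  then show "cobd_bound (k - 1) c" by (simp add: cobd_bound_def)
next
  assume "cobd_bound (k - 1) c"
  then have bound: "sqnorm (simplices X k) (D (k - 1) \<phi>) \<le> c * sqnorm (simplices X (k - 1)) \<phi>"
    if "\<phi> \<in> l2 (simplices X (k - 1))" for \<phi>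
    using that by (simp add: cobd_bound_def)
  show "max_eigenvalue cj X d Down k \<le> c"
  proof (rule max_eigenvalue_leI)
    fix \<phi> :: "'v set \<Rightarrow> 'a" assume \<phi>: "\<phi> \<in> l2 (simplices X k)"
    have "sqnorm (simplices X (k - 1)) (B (k - 1) \<phi>) \<le> c * sqnorm (simplices X k) \<phi>"
      by (rule adjoint_bound[where D = "D (k - 1)" and S = "simplices X (k - 1)" and T = "simplices X k"])
        (simp_all add: fin_simplices l2_linear_in_l2[OF Bk1] l2_linear_in_l2[OF Dk1] inner_D1 bound c \<phi>)
    then show "form Down k \<phi> \<le> c * sqnorm (simplices X k) \<phi>" by simp
  qed
qed

text \<open>On an eigenvector \<open>\<phi>\<close> of the Hodge Laplacian either \<open>B \<phi> = 0\<close>, and \<open>\<phi>\<close> is an eigenvector of the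
  up Laplacian, or \<open>B \<phi>\<close> is an eigenvector of the up Laplacian one dimension below, because \<open>D D = 0\<close>.\<close>

lemma max_hodge_le_iff:
  assumes c: "0 \<le> c"
  shows "max_eigenvalue cj X d Hodge k \<le> c \<longleftrightarrow> cobd_bound (k - 1) c \<and> cobd_bound k c"
proof
  assume le: "max_eigenvalue cj X d Hodge k \<le> c"
  \<comment> \<open>Both summands of the Hodge form are nonnegative, so a bound on the sum bounds
    each.\<close>
  have "form Up k \<phi> \<le> c * sqnorm (simplices X k) \<phi>" "form Down k \<phi> \<le> c * sqnorm (simplices X k) \<phi>"
    if "\<phi> \<in> l2 (simplices X k)" for \<phi>
    using form_le_max_eigenvalue[OF that, of Hodge] mult_right_mono[OF le sqnorm_nonneg, of "simplices X k" \<phi>]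
      form_nonneg[of Up k \<phi>] form_nonneg[of Down k \<phi>]
    unfolding form.simps by linarith+
  then show "cobd_bound (k - 1) c \<and> cobd_bound k c"
    using max_eigenvalue_leI max_up_le_iff max_down_le_iff[OF c] by blast
next
  assume bounds: "cobd_bound (k - 1) c \<and> cobd_bound k c"
  define l where "l = max_eigenvalue cj X d Hodge k"
  obtain \<phi> where \<phi>: "\<phi> \<in> l2 (simplices X k)" "\<phi> \<noteq> (\<lambda>_. 0)"
    and eigen: "laplacian cj X d Hodge k \<phi> = (\<lambda>x. of_real l * \<phi> x)"
    unfolding l_def using max_eigenvector[of Hodge] by blast
  define \<beta> where "\<beta> = B (k - 1) \<phi>"
  have \<beta>: "\<beta> \<in> l2 (simplices X (k - 1))"
    unfolding \<beta>_def by (rule l2_linear_in_l2[OF Bk1 \<phi>(1)])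
  have D\<beta>: "D (k - 1) \<beta> \<in> l2 (simplices X k)"
    by (rule l2_linear_in_l2[OF Dk1 \<beta>])
  have down: "down_laplacian cj X d k \<phi> = D (k - 1) \<beta>"
    by (simp add: down_laplacian_def \<beta>_def)
  show "max_eigenvalue cj X d Hodge k \<le> c"
  proof (cases "\<beta> = (\<lambda>_. 0)")
    case True
    have "D (k - 1) \<beta> = (\<lambda>_. 0)"
      unfolding True by (rule l2_linear_zero[OF Dk1])
    then have "up_laplacian cj X d k \<phi> = (\<lambda>x. of_real l * \<phi> x)"
      using eigen by (simp add: down)
    then have "of_real (form Up k \<phi>) = (of_real (l * sqnorm (simplices X k) \<phi>) :: 'a)"
      using inner_up(1)[OF \<phi>(1) \<phi>(1)] by (simp add: inner_scale_left inner_self)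
    then have "form Up k \<phi> = l * sqnorm (simplices X k) \<phi>"
      unfolding of_real_eq_iff .
    moreover have "form Up k \<phi> \<le> c * sqnorm (simplices X k) \<phi>"
      using bounds \<phi>(1) by (simp add: cobd_bound_def)
    ultimately have "l * sqnorm (simplices X k) \<phi> \<le> c * sqnorm (simplices X k) \<phi>"
      by simp
    moreover have "sqnorm (simplices X k) \<phi> > 0"
      using sqnorm_eq_0_iff[OF fin_simplices \<phi>(1)] sqnorm_nonneg[of "simplices X k" \<phi>] \<phi>(2) by linarith
    ultimately show ?thesis by (simp add: l_def)
  next
    case False
    \<comment> \<open>Pairing the eigenvalue equation with \<open>D (k - 1) \<beta>\<close> removes
      the up part, since two successive coboundaries vanish.\<close>
    have "of_real (l * sqnorm (simplices X (k - 1)) \<beta>) = of_real l * inner (simplices X (k - 1)) \<beta> \<beta>"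
      by (simp add: inner_self)
    also have "\<dots> = inner (simplices X k) (laplacian cj X d Hodge k \<phi>) (D (k - 1) \<beta>)"
      unfolding eigen inner_scale_left by (simp add: \<beta>_def inner_B1[symmetric] l2_linear_in_l2[OF Bk1 \<phi>(1)])
    also have "\<dots> = inner (simplices X (k + 1)) (D k \<phi>) (D k (D (k - 1) \<beta>))
        + inner (simplices X k) (D (k - 1) \<beta>) (D (k - 1) \<beta>)"
      by (simp add: inner_add_left inner_up(1)[OF \<phi>(1) D\<beta>] down)
    also have "D k (D (k - 1) \<beta>) = (\<lambda>_. 0)"
      using D_D[OF k_bounds(2) \<beta>] by simp
    finally have "l * sqnorm (simplices X (k - 1)) \<beta> = sqnorm (simplices X k) (D (k - 1) \<beta>)"
      by (simp only: inner_zero_right inner_self add_0 of_real_eq_iff)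
    then have "l * sqnorm (simplices X (k - 1)) \<beta> \<le> c * sqnorm (simplices X (k - 1)) \<beta>"
      using bounds \<beta> by (simp add: cobd_bound_def)
    moreover have "sqnorm (simplices X (k - 1)) \<beta> > 0"
      using sqnorm_eq_0_iff[OF fin_simplices \<beta>] sqnorm_nonneg[of "simplices X (k - 1)" \<beta>] False by linarith
    ultimately show ?thesis by (simp add: l_def)
  qed
qed

end

section \<open>Comparison of neighbouring dimensions\<close>

lemma simplices_nonempty:
  assumes "-1 \<le> k" "k \<le> complex_dim X"
  shows "simplices X k \<noteq> {}"
proof -
  \<comment> \<open>The void complex has dimension -2, which \<open>-1 \<le> k\<close>
    excludes.\<close>
  have ne: "X \<noteq> {}" using assms by (auto simp: complex_dim_def)
  have fin_X: "finite X" using X fin_V by (auto simp: simplicial_complex_def intro: finite_subset)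
  have dims: "{k. simplices X k \<noteq> {}} = (\<lambda>\<sigma>. int (card \<sigma>) - 1) ` X"
    by (force simp: simplices_def)
  have "complex_dim X \<in> {k. simplices X k \<noteq> {}}"
    using ne fin_X Max_in[of "{k. simplices X k \<noteq> {}}"] by (simp add: complex_dim_def dims)
  then obtain \<sigma> where \<sigma>: "\<sigma> \<in> X" "int (card \<sigma>) = complex_dim X + 1"
    by (auto simp: simplices_def)
  then have "nat (k + 1) \<le> card \<sigma>" using assms by linarith
  then obtain \<tau> where \<tau>: "\<tau> \<subseteq> \<sigma>" "card \<tau> = nat (k + 1)"
    by (metis obtain_subset_with_card_n)
  then have "\<tau> \<in> simplices X k"
    using \<sigma> X assms by (auto simp: simplices_def simplicial_complex_def)
  then show ?thesis by blast
qed

theorem max_eigenvalue_antimono: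
  assumes "1 \<le> k" "k \<le> complex_dim X"
  shows "max_eigenvalue cj X d t k \<le> max_eigenvalue cj X d t (k - 1)"
proof -
  have k: "0 \<le> k" "0 \<le> k - 1" using assms by auto
  have ne: "simplices X k \<noteq> {}" "simplices X (k - 1) \<noteq> {}"
    using assms simplices_nonempty[of k] simplices_nonempty[of "k - 1"] by simp_all
  define c where "c = max_eigenvalue cj X d t (k - 1)"
  have c: "0 \<le> c" unfolding c_def by (rule max_eigenvalue_nonneg[OF k(2) ne(2)])
  \<comment> \<open>\<open>step\<close> lifts the bound from \<open>k - 1\<close> to
    \<open>k\<close>, for up and Hodge; \<open>step1\<close> lifts it from \<open>k - 2\<close> to
    \<open>k - 1\<close>, for down. With \<open>k = 1\<close> the latter starts at the empty
    simplex.\<close>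
  note step = cobd_bound_step[OF k(1) c] and step1 = cobd_bound_step[OF k(2) c]
  show ?thesis
  proof (cases t)
    case Up
    then show ?thesis
      using max_up_le_iff[OF k(2) ne(2), of c] max_up_le_iff[OF k(1) ne(1), of c] step by (simp add: c_def)
  next
    case Down
    then show ?thesis
      using max_down_le_iff[OF k(2) ne(2) c] max_down_le_iff[OF k(1) ne(1) c] step1 by (simp add: c_def)
  next
    case Hodge
    then show ?thesis
      using max_hodge_le_iff[OF k(2) ne(2) c] max_hodge_le_iff[OF k(1) ne(1) c] step by (simp add: c_def)
  qed
qed

text \<open>\<open>cobd_bound_step\<close> makes the second condition of
  \<open>max_hodge_le_iff\<close> redundant, so both maxima, themselves nonnegative, lie below the
  same nonnegative reals.\<close>

theorem max_hodge_eq_max_down: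
  assumes "1 \<le> k" "k \<le> complex_dim X"
  shows "max_eigenvalue cj X d Hodge k = max_eigenvalue cj X d Down k"
proof -
  have k: "0 \<le> k" using assms by auto
  have ne: "simplices X k \<noteq> {}" using assms simplices_nonempty[of k] by simp
  have "max_eigenvalue cj X d Hodge k \<le> c \<longleftrightarrow> max_eigenvalue cj X d Down k \<le> c" if "0 \<le> c" for c
    using max_hodge_le_iff[OF k ne that] max_down_le_iff[OF k ne that] cobd_bound_step[OF k that] by blast
  then show ?thesis
    using max_eigenvalue_nonneg[OF k ne] by (meson order_antisym order_refl)
qed

end

section \<open>Real and complex scalars\<close>

theorem corollary4p2:
  fixes V :: "'v set" and X :: "'v set set"
  assumes "finite V" and "simplicial_complex V X"
  shows
    "(\<forall>d :: int \<Rightarrow> ('v set \<Rightarrow> real) \<Rightarrow> ('v set \<Rightarrow> real).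
        coboundary_operators (Pow V) d \<longrightarrow>
        (\<forall>t k. 1 \<le> k \<and> k \<le> complex_dim X \<longrightarrow>
           max_eigenvalue (\<lambda>x. x) X d t k \<le> max_eigenvalue (\<lambda>x. x) X d t (k - 1)) \<and>
        (\<forall>k. 1 \<le> k \<and> k \<le> complex_dim X \<longrightarrow>
           max_eigenvalue (\<lambda>x. x) X d Hodge k = max_eigenvalue (\<lambda>x. x) X d Down k)) \<and>
     (\<forall>d :: int \<Rightarrow> ('v set \<Rightarrow> complex) \<Rightarrow> ('v set \<Rightarrow> complex).
        coboundary_operators (Pow V) d \<longrightarrow>
        (\<forall>t k. 1 \<le> k \<and> k \<le> complex_dim X \<longrightarrow>
           max_eigenvalue cnj X d t k \<le> max_eigenvalue cnj X d t (k - 1)) \<and>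
        (\<forall>k. 1 \<le> k \<and> k \<le> complex_dim X \<longrightarrow>
           max_eigenvalue cnj X d Hodge k = max_eigenvalue cnj X d Down k))"
proof (intro conjI allI impI; (elim conjE)?)
  have real: "simplicial_laplacian (\<lambda>x. x) V X d"
    if "coboundary_operators (Pow V) d" for d :: "int \<Rightarrow> ('v set \<Rightarrow> real) \<Rightarrow> ('v set \<Rightarrow> real)"
    using assms that by unfold_locales (simp_all add: power2_eq_square flip: abs_mult)
  have complex: "simplicial_laplacian cnj V X d"
    if "coboundary_operators (Pow V) d" for d :: "int \<Rightarrow> ('v set \<Rightarrow> complex) \<Rightarrow> ('v set \<Rightarrow> complex)"
    using assms that by unfold_locales (simp_all add: complex_norm_square[symmetric])
  note antimono = simplicial_laplacian.max_eigenvalue_antimono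
    and hodge = simplicial_laplacian.max_hodge_eq_max_down
  fix t :: laplacian_kind and k :: int
  assume k: "1 \<le> k" "k \<le> complex_dim X"
  show "max_eigenvalue (\<lambda>x. x) X d t k \<le> max_eigenvalue (\<lambda>x. x) X d t (k - 1)"
    and "max_eigenvalue (\<lambda>x. x) X d Hodge k = max_eigenvalue (\<lambda>x. x) X d Down k"
    if "coboundary_operators (Pow V) d" for d :: "int \<Rightarrow> ('v set \<Rightarrow> real) \<Rightarrow> ('v set \<Rightarrow> real)"
    using antimono[OF real[OF that] k] hodge[OF real[OF that] k] by blast+
  show "max_eigenvalue cnj X d t k \<le> max_eigenvalue cnj X d t (k - 1)"
    and "max_eigenvalue cnj X d Hodge k = max_eigenvalue cnj X d Down k"
    if "coboundary_operators (Pow V) d" for d :: "int \<Rightarrow> ('v set \<Rightarrow> complex) \<Rightarrow> ('v set \<Rightarrow> complex)"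
    using antimono[OF complex[OF that] k] hodge[OF complex[OF that] k] by blast+
qed

end
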